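(* Let $\Bbbk$ be a field, $S=\Bbbk[x_1,\dots,x_n]$, and let $I \subsetneq S$ be a squarefree monomial ideal. Assume that the minimal free resolution $\mathbb{F}$ of $S/I$ is a multigraded DGA. Then there exists a DG-ideal $J \subseteq \mathbb{T}$ in the Taylor resolution $\mathbb{T}$ of $S/I$ such that $\mathbb{F} \cong \mathbb{T}/J$ as multigraded DGAs over $S$.
   Context: $S$ carries the fine $\mathbb{Z}^n$-grading. Let $\mathbb{F}$ be a $\mathbb{Z}^n$-graded free resolution of $S/I$ with $\mathbb{F}_0=S$ and differential $\partial$, identified with $\bigoplus_i\mathbb{F}_i$; $|f|$ denotes the homological degree. $\mathbb{F}$ is a multigraded DGA if it is equipped with an $S$-linear map $*:\mathbb{F}\otimes_S\mathbb{F}\to\mathbb{F}$ respecting the $\mathbb{Z}^n$-grading, such that for all (homogeneous) $a,b,c$: (1) $*$ extends the usual multiplication on $\mathbb{F}_0=S$ and $1\in\mathbb{F}_0$ acts as the identity; (2) $\partial(a*b)=\partial(a)*b+(-1)^{|a|}a*\partial(b)$; (3) $|a*b|=|a|+|b|$; (4) $a*b=(-1)^{|a||b|}b*a$; (5) $(a*b)*c=a*(b*c)$. Let $G(I)$ be the set of minimal monomial generators of $I$, with a fixed total order $\prec$. For $W\subseteq G(I)$ put $m_W:=\operatorname{lcm}(m: m\in W)$. The Taylor resolution $\mathbb{T}$ of $S/I$ is the complex of free $S$-modules with basis $\{\mathbf{g}_W: W\subseteq G(I)\}$, $|\mathbf{g}_W|=\#W$, $\deg\mathbf{g}_W=\deg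 m_W$, and differential $\partial\mathbf{g}_W=\sum_{m\in W}(-1)^{\sigma(m,W)}\frac{m_W}{m_{W\setminus\{m\}}}\mathbf{g}_{W\setminus\{m\}}$, where $\sigma(m,W):=\#\{m'\in W: m'\prec m\}$. It is a DGA with the multiplication $\mathbf{g}_W*\mathbf{g}_V=(-1)^{\sigma(W,V)}\frac{m_Wm_V}{m_{W\cup V}}\mathbf{g}_{W\cup V}$ if $W\cap V=\emptyset$ and $\mathbf{g}_W*\mathbf{g}_V=0$ otherwise, where $\sigma(W,V):=\#\{(m,m')\in W\times V: m'\prec m\}$. A DG-ideal of $\mathbb{T}$ is a (homogeneous, two-sided) ideal $J$ of the algebra $\mathbb{T}$ with $\partial J\subseteq J$; an isomorphism of multigraded DGAs over $S$ is an $S$-linear isomorphism preserving the homological grading, the multigrading, the differential and the multiplication. *)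

theory Defs
  imports
    "HOL-Algebra.Module"
    "HOL-Algebra.QuotRing"
    "HOL-Algebra.Algebraic_Closure_Type"
    "HOL-Library.Poly_Mapping"
    "HOL-Library.Function_Algebras"
begin

section \<open>Monomials and squarefree monomial ideals\<close>

text \<open>
  The variables are indexed by a finite type \<open>'n\<close>. A monomial is given by its exponent vector
  \<open>a :: 'n \<Rightarrow> nat\<close>. All operations on exponent vectors are pointwise, so \<open>a + b\<close> is the exponent of
  the product, \<open>a \<le> b\<close> is divisibility, and \<open>b - a\<close> is the exponent of the quotient whenever
  \<open>a \<le> b\<close>.
\<close>

type_synonym ('n, 'k) mpoly = "('n \<Rightarrow> nat) \<Rightarrow>\<^sub>0 'k"

abbreviation poly_ring :: "('n, 'k::field) mpoly ring" where
  "poly_ring \<equiv> ring_of_type_algebra"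

definition xpow :: "('n \<Rightarrow> nat) \<Rightarrow> ('n, 'k::field) mpoly" where
  "xpow a = Poly_Mapping.single a 1"

definition xvar :: "'n \<Rightarrow> ('n, 'k::field) mpoly" where
  "xvar j = xpow (\<lambda>i. if i = j then 1 else 0)"

text \<open>The zero polynomial is homogeneous of every multidegree; if \<open>u\<close> has a negative entry, it is
  the only polynomial that is homogeneous of multidegree \<open>u\<close>.\<close>

definition homogeneous_poly :: "('n \<Rightarrow> int) \<Rightarrow> ('n, 'k::field) mpoly \<Rightarrow> bool" where
  "homogeneous_poly u p \<longleftrightarrow> (\<forall>a\<in>Poly_Mapping.keys p. (\<lambda>j. int (a j)) = u)"

definition squarefree_monomial_ideal :: "('n, 'k::field) mpoly set \<Rightarrow> bool" where
  "squarefree_monomial_ideal I \<longleftrightarrow>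
     (\<exists>A. (\<forall>a\<in>A. \<forall>j. a j \<le> 1) \<and> I = Idl\<^bsub>poly_ring\<^esub> (xpow ` A))"

definition min_gens :: "('n, 'k::field) mpoly set \<Rightarrow> ('n \<Rightarrow> nat) set" where
  "min_gens I = {a. xpow a \<in> I \<and> (\<forall>b. xpow b \<in> I \<and> b \<le> a \<longrightarrow> b = a)}"

definition lcm_exp :: "('n \<Rightarrow> nat) set \<Rightarrow> ('n \<Rightarrow> nat)" where
  "lcm_exp W = (\<lambda>j. Max (insert 0 ((\<lambda>a. a j) ` W)))"


section \<open>Multigraded complexes, resolutions and DGAs\<close>

text \<open>
  A complex \<open>F\<^sub>0 \<leftarrow> F\<^sub>1 \<leftarrow> \<dots>\<close> is identified with \<open>F = \<Oplus>\<^sub>i F\<^sub>i\<close>; \<open>bicomp F i u\<close> is the multidegree \<open>u\<close>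
  part of \<open>F\<^sub>i\<close>. The fields \<open>mult\<close> and \<open>one\<close> inherited from \<open>module\<close> hold the algebra structure;
  for a complex with \<open>F\<^sub>0 = S\<close>, the element \<open>one\<close> is the element \<open>1\<close> of \<open>F\<^sub>0\<close>.
\<close>

record ('n, 'k, 'f) mdga = "(('n, 'k) mpoly, 'f) module" +
  bdry :: "'f \<Rightarrow> 'f" (\<open>\<partial>\<index>\<close>)
  bicomp :: "nat \<Rightarrow> ('n \<Rightarrow> int) \<Rightarrow> 'f set"

definition internal_direct_sum :: "('f, 'm) ring_scheme \<Rightarrow> ('d \<Rightarrow> 'f set) \<Rightarrow> bool" where
  "internal_direct_sum M C \<longleftrightarrow>
     (\<forall>d. additive_subgroup (C d) M) \<and>
     (\<forall>x\<in>carrier M. \<exists>!f. (\<forall>d. f d \<in> C d) \<and> finite {d. f d \<noteq> \<zero>\<^bsub>M\<^esub>} \<and>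
        x = finsum M f {d. f d \<noteq> \<zero>\<^bsub>M\<^esub>})"

definition hom_part :: "('n, 'k::field, 'f) mdga \<Rightarrow> nat \<Rightarrow> 'f set" where
  "hom_part F i = {finsum F f {u. f u \<noteq> \<zero>\<^bsub>F\<^esub>} | f.
     (\<forall>u. f u \<in> bicomp F i u) \<and> finite {u. f u \<noteq> \<zero>\<^bsub>F\<^esub>}}"

definition free_basis :: "('n, 'k::field, 'f) mdga \<Rightarrow> 'f set \<Rightarrow> bool" where
  "free_basis F B \<longleftrightarrow> B \<subseteq> carrier F \<and>
     (\<forall>x\<in>carrier F. \<exists>!c. {b. c b \<noteq> 0} \<subseteq> B \<and> finite {b. c b \<noteq> 0} \<and>
        x = finsum F (\<lambda>b. c b \<odot>\<^bsub>F\<^esub> b) {b. c b \<noteq> 0})"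

locale multigraded_complex = module poly_ring F
  for F :: "('n::finite, 'k::field, 'f) mdga" (structure) +
  assumes bigraded: "internal_direct_sum F (\<lambda>(i, u). bicomp F i u)"
    and smult_bicomp: "\<lbrakk>homogeneous_poly v s; x \<in> bicomp F i u\<rbrakk> \<Longrightarrow> s \<odot> x \<in> bicomp F i (v + u)"
    and bdry_closed: "x \<in> carrier F \<Longrightarrow> \<partial> x \<in> carrier F"
    and bdry_add: "\<lbrakk>x \<in> carrier F; y \<in> carrier F\<rbrakk> \<Longrightarrow> \<partial> (x \<oplus> y) = \<partial> x \<oplus> \<partial> y"
    and bdry_smult: "x \<in> carrier F \<Longrightarrow> \<partial> (s \<odot> x) = s \<odot> \<partial> x"
    and bdry_bicomp_0: "x \<in> bicomp F 0 u \<Longrightarrow> \<partial> x = \<zero>"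
    and bdry_bicomp_Suc: "x \<in> bicomp F (Suc i) u \<Longrightarrow> \<partial> x \<in> bicomp F i u"
    and bdry_bdry: "x \<in> carrier F \<Longrightarrow> \<partial> (\<partial> x) = \<zero>"

text \<open>
  A multigraded free resolution of \<open>S/I\<close> with \<open>F\<^sub>0 = S\<close>, the identification of \<open>S\<close> with \<open>F\<^sub>0\<close> being
  \<open>s \<mapsto> s \<odot> \<one>\<close>. The augmentation \<open>F\<^sub>0 = S \<rightarrow> S/I\<close> is the canonical projection, so exactness at
  \<open>F\<^sub>0\<close> says that the image of \<open>F\<^sub>1\<close> is \<open>I\<close>.
\<close>

locale multigraded_free_resolution = multigraded_complex F
  for I :: "('n::finite, 'k::field) mpoly set" and F :: "('n, 'k, 'f) mdga" (structure) +
  assumes graded_free: "\<exists>B. B \<subseteq> (\<Union>i u. bicomp F i u) \<and> free_basis F B"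
    and one_bicomp: "\<one> \<in> bicomp F 0 0"
    and hom_part_0: "bij_betw (\<lambda>s. s \<odot> \<one>) UNIV (hom_part F 0)"
    and exact_0: "bdry F ` hom_part F 1 = (\<lambda>s. s \<odot> \<one>) ` I"
    and exact_Suc: "\<lbrakk>x \<in> hom_part F (Suc i); \<partial> x = \<zero>\<rbrakk> \<Longrightarrow> x \<in> bdry F ` hom_part F (Suc (Suc i))"

text \<open>Minimality: \<open>\<partial> F \<subseteq> \<mm> F\<close> for \<open>\<mm> = (x\<^sub>1, \<dots>, x\<^sub>n)\<close>, where \<open>\<mm> F = x\<^sub>1 F + \<dots> + x\<^sub>n F\<close>.\<close>

locale minimal_multigraded_free_resolution = multigraded_free_resolution I F
  for I :: "('n::finite, 'k::field) mpoly set" and F :: "('n, 'k, 'f) mdga" (structure) +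
  assumes minimal: "x \<in> carrier F \<Longrightarrow>
    \<exists>f. range f \<subseteq> carrier F \<and> \<partial> x = finsum F (\<lambda>j. xvar j \<odot> f j) UNIV"

text \<open>Associativity, distributivity and the identity element come from \<open>ring F\<close>. Together with
  \<open>S\<close>-bilinearity, the latter implies that the product extends the one of \<open>S\<close>; see
  \<open>mult_extends\<close> below.\<close>

locale multigraded_dga = multigraded_complex F + ring F
  for F :: "('n::finite, 'k::field, 'f) mdga" (structure) +
  assumes one_bicomp: "\<one> \<in> bicomp F 0 0"
    and smult_mult_left: "\<lbrakk>x \<in> carrier F; y \<in> carrier F\<rbrakk> \<Longrightarrow> (s \<odot> x) \<otimes> y = s \<odot> (x \<otimes> y)"
    and smult_mult_right: "\<lbrakk>x \<in> carrier F; y \<in> carrier F\<rbrakk> \<Longrightarrow> x \<otimes> (s \<odot> y) = s \<odot> (x \<otimes> y)"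
    and mult_bicomp:
      "\<lbrakk>x \<in> bicomp F i u; y \<in> bicomp F j v\<rbrakk> \<Longrightarrow> x \<otimes> y \<in> bicomp F (i + j) (u + v)"
    and leibniz: "\<lbrakk>x \<in> bicomp F i u; y \<in> bicomp F j v\<rbrakk> \<Longrightarrow>
      \<partial> (x \<otimes> y) = (\<partial> x \<otimes> y) \<oplus> ((-1) ^ i \<odot> (x \<otimes> \<partial> y))"
    and graded_comm: "\<lbrakk>x \<in> bicomp F i u; y \<in> bicomp F j v\<rbrakk> \<Longrightarrow>
      x \<otimes> y = (-1) ^ (i * j) \<odot> (y \<otimes> x)"
begin

lemma mult_extends: "(s \<odot> \<one>) \<otimes> (t \<odot> \<one>) = (s * t) \<odot> \<one>"
proof -
  have c: "r \<odot> \<one> \<in> carrier F" for r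
    by (rule smult_closed) (simp_all add: ring_of_type_algebra_def)
  have "(s \<odot> \<one>) \<otimes> (t \<odot> \<one>) = s \<odot> (t \<odot> \<one>)"
    using smult_mult_left[OF one_closed c[of t], of s] c[of t] by simp
  also have "\<dots> = (s * t) \<odot> \<one>"
    using smult_assoc1[of s t \<one>] by (simp add: ring_of_type_algebra_def)
  finally show ?thesis .
qed

end


section \<open>DG-ideals, quotients and isomorphisms\<close>

text \<open>Homogeneity of \<open>J\<close>: every element of \<open>J\<close> is a sum of bihomogeneous elements of \<open>J\<close>.\<close>

locale dg_ideal = ideal J T
  for J :: "'f set" and T :: "('n::finite, 'k::field, 'f) mdga" (structure) +
  assumes homogeneous: "x \<in> J \<Longrightarrow>
      \<exists>f. (\<forall>i u. f (i, u) \<in> J \<inter> bicomp T i u) \<and> finite {d. f d \<noteq> \<zero>} \<and>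
        x = finsum T f {d. f d \<noteq> \<zero>}"
    and bdry_ideal: "bdry T ` J \<subseteq> J"

definition dg_quotient ::
  "('n, 'k::field, 'f) mdga \<Rightarrow> 'f set \<Rightarrow> ('n, 'k, 'f set) mdga" where
  "dg_quotient T J =
     \<lparr>carrier = carrier (T Quot J), monoid.mult = monoid.mult (T Quot J), monoid.one = monoid.one (T Quot J),
      ring.zero = ring.zero (T Quot J), ring.add = ring.add (T Quot J),
      module.smult = (\<lambda>s A. \<Union>x\<in>A. J +>\<^bsub>T\<^esub> (s \<odot>\<^bsub>T\<^esub> x)),
      bdry = (\<lambda>A. \<Union>x\<in>A. J +>\<^bsub>T\<^esub> bdry T x),
      bicomp = (\<lambda>i u. (\<lambda>x. J +>\<^bsub>T\<^esub> x) ` bicomp T i u)\<rparr>"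

definition mdga_iso ::
  "('n, 'k::field, 'f) mdga \<Rightarrow> ('n, 'k, 'g) mdga \<Rightarrow> ('f \<Rightarrow> 'g) set" where
  "mdga_iso A B = {\<phi> \<in> ring_iso A B.
     (\<forall>s. \<forall>x\<in>carrier A. \<phi> (s \<odot>\<^bsub>A\<^esub> x) = s \<odot>\<^bsub>B\<^esub> \<phi> x) \<and>
     (\<forall>x\<in>carrier A. \<phi> (bdry A x) = bdry B (\<phi> x)) \<and>
     (\<forall>i u. \<phi> ` bicomp A i u = bicomp B i u)}"


section \<open>The Taylor resolution\<close>

text \<open>
  The basis element \<open>g\<^sub>W\<close> is \<open>Poly_Mapping.single W 1\<close>. The strict total order on \<open>G(I)\<close> is
  a relation \<open>r\<close>, where \<open>(m', m) \<in> r\<close> means that \<open>m'\<close> precedes \<open>m\<close>.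
\<close>

definition taylor_bdry :: "(('n \<Rightarrow> nat) \<times> ('n \<Rightarrow> nat)) set \<Rightarrow>
    (('n \<Rightarrow> nat) set \<Rightarrow>\<^sub>0 ('n, 'k::field) mpoly) \<Rightarrow> (('n \<Rightarrow> nat) set \<Rightarrow>\<^sub>0 ('n, 'k) mpoly)" where
  "taylor_bdry r t = (\<Sum>W\<in>Poly_Mapping.keys t. \<Sum>m\<in>W. Poly_Mapping.single (W - {m})
     (Poly_Mapping.lookup t W * ((-1) ^ card {m'\<in>W. (m', m) \<in> r} * xpow (lcm_exp W - lcm_exp (W - {m})))))"

definition taylor_basis_mult :: "(('n \<Rightarrow> nat) \<times> ('n \<Rightarrow> nat)) set \<Rightarrow>
    ('n \<Rightarrow> nat) set \<Rightarrow> ('n \<Rightarrow> nat) set \<Rightarrow> ('n, 'k::field) mpoly" where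
  "taylor_basis_mult r W V =
     (if W \<inter> V = {}
      then (-1) ^ card {(m, m'). m \<in> W \<and> m' \<in> V \<and> (m', m) \<in> r} *
           xpow (lcm_exp W + lcm_exp V - lcm_exp (W \<union> V))
      else 0)"

definition taylor_mult :: "(('n \<Rightarrow> nat) \<times> ('n \<Rightarrow> nat)) set \<Rightarrow>
    (('n \<Rightarrow> nat) set \<Rightarrow>\<^sub>0 ('n, 'k::field) mpoly) \<Rightarrow> (('n \<Rightarrow> nat) set \<Rightarrow>\<^sub>0 ('n, 'k) mpoly) \<Rightarrow>
    (('n \<Rightarrow> nat) set \<Rightarrow>\<^sub>0 ('n, 'k) mpoly)" where
  "taylor_mult r t t' = (\<Sum>W\<in>Poly_Mapping.keys t. \<Sum>V\<in>Poly_Mapping.keys t'. Poly_Mapping.single (W \<union> V)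
     (Poly_Mapping.lookup t W * Poly_Mapping.lookup t' V * taylor_basis_mult r W V))"

definition taylor :: "('n, 'k::field) mpoly set \<Rightarrow> (('n \<Rightarrow> nat) \<times> ('n \<Rightarrow> nat)) set \<Rightarrow>
    ('n, 'k, ('n \<Rightarrow> nat) set \<Rightarrow>\<^sub>0 ('n, 'k) mpoly) mdga" where
  "taylor I r =
     \<lparr>carrier = {t. Poly_Mapping.keys t \<subseteq> Pow (min_gens I)},
      monoid.mult = taylor_mult r, monoid.one = Poly_Mapping.single {} 1,
      ring.zero = 0, ring.add = (+),
      module.smult = (\<lambda>s. Poly_Mapping.map ((*) s)),
      bdry = taylor_bdry r,
      bicomp = (\<lambda>i u. {t. Poly_Mapping.keys t \<subseteq> Pow (min_gens I) \<and>
        (\<forall>W\<in>Poly_Mapping.keys t. card W = i \<and>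
           homogeneous_poly (u - (\<lambda>j. int (lcm_exp W j))) (Poly_Mapping.lookup t W))})\<rparr>"

end

theory Submission
  imports Defs
begin

text \<open>
  For a minimal generator \<open>m\<close> of \<open>I\<close> choose \<open>g\<^sub>m\<close> in \<open>F\<^sub>1\<close> of multidegree \<open>m\<close> with \<open>\<partial> g\<^sub>m = x\<^sup>m\<close>. The
  ordered products of the \<open>g\<^sub>m\<close> with \<open>m \<in> W\<close> multiply and differentiate like the basis elements of
  the Taylor resolution, except that such a product has the multidegree \<open>\<Sum>W\<close> instead of \<open>lcm W\<close>. The
  idea is to divide it by the monomial of multidegree \<open>\<Sum>W - lcm W\<close>. This is possible because \<open>I\<close> is squarefree:
  \<open>F\<close> is then generated in squarefree multidegrees, so that multiplication by \<open>x\<^sub>j\<close> maps the part of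
  \<open>F\<close> of degree \<open>u\<close> onto that of degree \<open>u + e\<^sub>j\<close> as soon as \<open>u\<^sub>j \<ge> 1\<close> (\<open>divisible_by_var\<close>). As \<open>F\<close> is
  torsion-free, the quotients \<open>img W\<close> satisfy the Taylor relations \<open>img_mult\<close> and \<open>img_bdry\<close>, and
  \<open>g\<^sub>W \<mapsto> img W\<close> defines a morphism \<open>comparison\<close> of multigraded DGAs from the Taylor resolution to \<open>F\<close>.

  That \<open>g\<^sub>m * g\<^sub>m = 0\<close> needs an argument in characteristic two: the square is \<open>x\<^sup>m y\<close> for some \<open>y\<close> in
  \<open>F\<^sub>2\<close> of multidegree \<open>m\<close>, and by minimality there is no such \<open>y\<close> but zero (\<open>gen_square\<close>).

  The morphism is onto (\<open>comparison_surj_bicomp\<close>). If \<open>x\<close> has positive homological degree and a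
  multidegree \<open>u\<close> divisible by \<open>m\<close>, then by the Leibniz rule \<open>x\<close> and \<open>z = (g\<^sub>m * \<partial> x) / x\<^sup>m\<close> have the
  same boundary. By induction \<open>\<partial> x\<close> is in the image, hence so is \<open>z\<close>; and \<open>x - z\<close>, being a cycle, is a
  boundary, hence lies in \<open>\<mm> F\<close> by minimality and is treated by induction on the multidegree
  (\<open>graded_nakayama\<close>). If no generator divides \<open>u\<close>, then \<open>x = 0\<close> (\<open>bicomp_eq_zero\<close>). The
  kernel of the morphism is the desired DG-ideal.
\<close>

section \<open>Monomials\<close>

abbreviation exp_unit :: "'n \<Rightarrow> ('n \<Rightarrow> nat)" where
  "exp_unit j \<equiv> (\<lambda>i. if i = j then 1 else 0)"

abbreviation mdeg :: "('n \<Rightarrow> nat) \<Rightarrow> ('n \<Rightarrow> int)" where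
  "mdeg a \<equiv> (\<lambda>j. int (a j))"

lemma poly_mapping_eq_sum_single:
  "p = (\<Sum>a\<in>Poly_Mapping.keys p. Poly_Mapping.single a (Poly_Mapping.lookup p a))"
  by (rule poly_mapping_eqI) (simp add: lookup_sum lookup_single when_def not_in_keys_iff_lookup_eq_zero)

lemma xpow_add: "xpow (a + b) = xpow a * xpow b"
  by (simp add: xpow_def mult_single)

lemma xpow_0 [simp]: "xpow (\<lambda>_. 0) = 1"
  unfolding xpow_def zero_fun_def[symmetric] by simp

lemma xpow_mult_single: "xpow a * Poly_Mapping.single b c = Poly_Mapping.single (a + b) c"
  by (simp add: xpow_def mult_single)

lemma lookup_xpow_mult:
  fixes p :: "('n, 'k::field) mpoly"
  shows "Poly_Mapping.lookup (xpow a * p) e =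
    (if a \<le> e then Poly_Mapping.lookup p (e - a) else 0)"
proof -
  have split: "e = a + b \<longleftrightarrow> a \<le> e \<and> b = e - a" for b :: "'n \<Rightarrow> nat"
  proof
    show "a \<le> e \<and> b = e - a" if "e = a + b"
      unfolding that by (simp add: le_fun_def fun_eq_iff)
    show "e = a + b" if "a \<le> e \<and> b = e - a"
      using that by (simp add: le_fun_def fun_eq_iff)
  qed
  have "xpow a * p = (\<Sum>b\<in>Poly_Mapping.keys p. Poly_Mapping.single (a + b) (Poly_Mapping.lookup p b))"
    by (subst poly_mapping_eq_sum_single[of p]) (simp add: sum_distrib_left xpow_mult_single)
  then have "Poly_Mapping.lookup (xpow a * p) e =
      (\<Sum>b\<in>Poly_Mapping.keys p. if e = a + b then Poly_Mapping.lookup p b else 0)"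
    by (auto simp: lookup_sum lookup_single when_def intro!: sum.cong)
  then show ?thesis
    unfolding split by (cases "a \<le> e") (simp_all add: not_in_keys_iff_lookup_eq_zero)
qed

lemma xpow_mult_cancel: 
  assumes "xpow a * p = xpow a * (q :: ('n, 'k::field) mpoly)"
  shows "p = q"
proof (rule poly_mapping_eqI)
  fix e
  have "Poly_Mapping.lookup (xpow a * p) (a + e) = Poly_Mapping.lookup (xpow a * q) (a + e)"
    by (simp add: assms)
  moreover have "a \<le> a + e" "a + e - a = e"
    by (simp_all add: le_fun_def fun_eq_iff)
  ultimately show "Poly_Mapping.lookup p e = Poly_Mapping.lookup q e"
    by (simp add: lookup_xpow_mult)
qed

lemma homogeneous_single: "homogeneous_poly (mdeg a) (Poly_Mapping.single a c)"
  by (simp add: homogeneous_poly_def)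

lemma homogeneous_xpow: "homogeneous_poly (mdeg a) (xpow a)"
  by (simp add: xpow_def homogeneous_single)

lemma homogeneous_polyE:
  fixes p :: "('n, 'k::field) mpoly"
  assumes "homogeneous_poly u p" "p \<noteq> 0"
  obtains a c where "u = mdeg a" "p = Poly_Mapping.single a c"
proof -
  obtain a where a: "a \<in> Poly_Mapping.keys p"
    using assms(2) by fastforce
  have "b = a" if "b \<in> Poly_Mapping.keys p" for b
  proof -
    have "mdeg b = mdeg a"
      using assms(1) a that by (simp add: homogeneous_poly_def)
    then show ?thesis by (simp add: fun_eq_iff)
  qed
  with a have "Poly_Mapping.keys p = {a}" by blast
  then have "p = Poly_Mapping.single a (Poly_Mapping.lookup p a)"
    by (subst poly_mapping_eq_sum_single) simp
  moreover have "u = mdeg a"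
    using assms(1) a by (simp add: homogeneous_poly_def)
  ultimately show thesis by (intro that)
qed

lemma carrier_poly_ring [simp]: "carrier poly_ring = UNIV"
  and zero_poly_ring [simp]: "\<zero>\<^bsub>poly_ring\<^esub> = 0"
  and one_poly_ring [simp]: "\<one>\<^bsub>poly_ring\<^esub> = 1"
  and add_poly_ring [simp]: "p \<oplus>\<^bsub>poly_ring\<^esub> q = p + q"
  and mult_poly_ring [simp]: "p \<otimes>\<^bsub>poly_ring\<^esub> q = p * q"
  by (simp_all add: ring_of_type_algebra_def)


section \<open>Squarefree monomial ideals\<close>

lemma monomial_ideal_keys:
  assumes "p \<in> Idl\<^bsub>poly_ring\<^esub> (xpow ` A)" "e \<in> Poly_Mapping.keys p"
  obtains a where "a \<in> A" "a \<le> e"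
proof -
  interpret R: cring "poly_ring :: ('a, 'b) mpoly ring"
    by (rule cring_from_type_algebra)
  define M where "M = {q :: ('a, 'b) mpoly. \<forall>e\<in>Poly_Mapping.keys q. \<exists>a\<in>A. a \<le> e}"
  have le_add: "a \<le> b + e" if "a \<le> e" for a b e :: "'a \<Rightarrow> nat"
    using that by (simp add: le_fun_def trans_le_add2)
  have closed: "q * p \<in> M" if "p \<in> M" for p q
  proof -
    have "\<exists>a\<in>A. a \<le> e" if e: "e \<in> Poly_Mapping.keys (q * p)" for e
    proof -
      obtain b c where "e = b + c" "c \<in> Poly_Mapping.keys p"
        using keys_mult[of q p] e by blast
      with \<open>p \<in> M\<close> le_add show ?thesis
        unfolding M_def by blast
    qed
    then show ?thesis by (simp add: M_def)
  qed
  have uminus: "- p \<in> M" if "p \<in> M" for p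
    using closed[OF that, of "- 1"] by simp
  have inv: "\<ominus>\<^bsub>poly_ring\<^esub> p = - p" for p :: "('a, 'b) mpoly"
    by (rule R.minus_equality) simp_all
  have "ideal M poly_ring"
  proof (rule idealI)
    show "subgroup M (add_monoid poly_ring)"
    proof (rule group.subgroupI[OF R.add.is_group])
      show "p \<otimes>\<^bsub>add_monoid poly_ring\<^esub> q \<in> M" if "p \<in> M" "q \<in> M" for p q
        using that keys_add[of p q] by (auto simp: M_def)
      have "0 \<in> M" by (simp add: M_def)
      then show "M \<noteq> {}" by blast
      show "inv\<^bsub>add_monoid poly_ring\<^esub> p \<in> M" if "p \<in> M" for p
        using uminus[OF that] inv[of p] by (simp add: a_inv_def)
    qed simp
  qed (use closed R.m_comm in \<open>simp_all add: R.ring_axioms mult.commute\<close>)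
  moreover have "xpow ` A \<subseteq> M"
    by (auto simp: M_def xpow_def)
  ultimately have "Idl\<^bsub>poly_ring\<^esub> (xpow ` A) \<subseteq> M"
    by (rule R.genideal_minimal)
  then show thesis
    using assms that by (auto simp: M_def)
qed

locale squarefree_ideal =
  fixes I :: "('n::finite, 'k::field) mpoly set"
  assumes squarefree: "squarefree_monomial_ideal I"
begin

lemma ideal_mult: "p \<in> I \<Longrightarrow> q * p \<in> I"
proof -
  interpret R: cring "poly_ring :: ('n, 'k) mpoly ring"
    by (rule cring_from_type_algebra)
  obtain A where "I = Idl\<^bsub>poly_ring\<^esub> (xpow ` A)"
    using squarefree unfolding squarefree_monomial_ideal_def by blast
  then have "ideal I poly_ring"
    by (simp add: R.genideal_ideal)
  from ideal.I_l_closed[OF this, of p q] show "p \<in> I \<Longrightarrow> q * p \<in> I"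
    by simp
qed

lemma single_mem_ideal:
  assumes "Poly_Mapping.single a c \<in> I" "c \<noteq> 0"
  shows "xpow a \<in> I"
proof -
  have "Poly_Mapping.single 0 (inverse c) * Poly_Mapping.single a c = xpow a"
    using assms(2) by (simp add: mult_single xpow_def)
  with ideal_mult[OF assms(1)] show ?thesis by metis
qed

lemma xpow_mem_mono:
  assumes "xpow a \<in> I" "a \<le> b"
  shows "Poly_Mapping.single b c \<in> I"
proof -
  have "b - a + a = b"
    using assms(2) by (simp add: le_fun_def fun_eq_iff)
  then have "Poly_Mapping.single (b - a) c * xpow a = Poly_Mapping.single b c"
    by (simp add: xpow_def mult_single)
  with ideal_mult[OF assms(1)] show ?thesis by metis
qed

text \<open>A monomial in the ideal is divisible by one of the squarefree monomials that generate it, so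
  a minimal one must be among these.\<close>

lemma squarefree_divisor:
  assumes "xpow a \<in> I"
  obtains b where "xpow b \<in> I" "b \<le> a" "\<And>j. b j \<le> 1"
proof -
  interpret R: cring "poly_ring :: ('n, 'k) mpoly ring"
    by (rule cring_from_type_algebra)
  obtain A where A: "\<forall>a\<in>A. \<forall>j. a j \<le> 1" and I: "I = Idl\<^bsub>poly_ring\<^esub> (xpow ` A)"
    using squarefree unfolding squarefree_monomial_ideal_def by blast
  have "a \<in> Poly_Mapping.keys (xpow a :: ('n, 'k) mpoly)"
    by (simp add: xpow_def)
  with assms obtain b where "b \<in> A" "b \<le> a"
    unfolding I by (rule monomial_ideal_keys)
  moreover have "xpow ` A \<subseteq> I"
    unfolding I by (rule R.genideal_self) simp
  ultimately show thesis
    using that[of b] A by auto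
qed

lemma min_gen_squarefree: "m \<in> min_gens I \<Longrightarrow> m j \<le> 1"
  by (metis (mono_tags, lifting) mem_Collect_eq min_gens_def squarefree_divisor)

lemma finite_min_gens: "finite (min_gens I)"
proof (rule finite_subset)
  show "min_gens I \<subseteq> UNIV \<rightarrow>\<^sub>E {0, 1}"
    using min_gen_squarefree by (force simp: PiE_def le_Suc_eq)
  show "finite (UNIV \<rightarrow>\<^sub>E {0, 1 :: nat} :: ('n \<Rightarrow> nat) set)"
    by (rule finite_PiE) simp_all
qed

lemma min_gen_divisor:
  assumes "xpow a \<in> I"
  obtains m where "m \<in> min_gens I" "m \<le> a"
  using assms
proof (induction "sum a UNIV" arbitrary: a thesis rule: less_induct)
  case less
  show ?case
  proof (cases "a \<in> min_gens I")
    case True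
    then show ?thesis using less.prems(1) by blast
  next
    case False
    then obtain b where b: "xpow b \<in> I" "b \<le> a" "b \<noteq> a"
      using less.prems(2) by (auto simp: min_gens_def)
    have "sum b UNIV < sum a UNIV"
      using b(2,3) by (intro sum_strict_mono_ex1) (auto simp: le_fun_def fun_eq_iff nat_less_le)
    then obtain m where "m \<in> min_gens I" "m \<le> b"
      using less.hyps[OF _ _ b(1)] by blast
    with b(2) less.prems(1) show ?thesis
      by (meson order.trans)
  qed
qed

end

section \<open>Homogeneous components and coordinates\<close>

context multigraded_complex
begin

lemma smult_carrier [simp, intro]: "x \<in> carrier F \<Longrightarrow> s \<odot> x \<in> carrier F"
  by (simp add: smult_closed)

lemma smult_zero [simp]: "s \<odot> \<zero> = \<zero>"
  by (simp add: smult_r_null)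

lemma zero_smult [simp]: "x \<in> carrier F \<Longrightarrow> 0 \<odot> x = \<zero>"
  using smult_l_null[of x] by simp

lemma one_smult [simp]: "x \<in> carrier F \<Longrightarrow> 1 \<odot> x = x"
  using smult_one[of x] by simp

lemma smult_smult [simp]: "x \<in> carrier F \<Longrightarrow> s \<odot> (t \<odot> x) = (s * t) \<odot> x"
  using smult_assoc1[of s t x] by simp

lemma smult_add: "\<lbrakk>x \<in> carrier F; y \<in> carrier F\<rbrakk> \<Longrightarrow> s \<odot> (x \<oplus> y) = s \<odot> x \<oplus> s \<odot> y"
  by (simp add: smult_r_distr)

lemma add_smult: "x \<in> carrier F \<Longrightarrow> (s + t) \<odot> x = s \<odot> x \<oplus> t \<odot> x"
  using smult_l_distr[of s t x] by simp

lemma hom_finsum: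
  assumes "\<And>x. x \<in> carrier F \<Longrightarrow> h x \<in> carrier F"
    and "\<And>x y. \<lbrakk>x \<in> carrier F; y \<in> carrier F\<rbrakk> \<Longrightarrow> h (x \<oplus> y) = h x \<oplus> h y"
    and "f \<in> A \<rightarrow> carrier F"
  shows "h (finsum F f A) = finsum F (\<lambda>a. h (f a)) A"
proof -
  have "h \<zero> \<oplus> h \<zero> = h \<zero>"
    using assms(2)[of \<zero> \<zero>] by simp
  then have zero: "h \<zero> = \<zero>"
    using assms(1)[of \<zero>] by (simp add: M.add.l_cancel_one')
  from assms(3) show ?thesis
  proof (induction A rule: infinite_finite_induct)
    case (insert a A)
    moreover have "(\<lambda>a. h (f a)) \<in> A \<rightarrow> carrier F"
      using insert.prems assms(1) by auto
    ultimately show ?case by (simp add: assms(1,2))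
  qed (simp_all add: zero)
qed

lemma smult_finsum:
  "f \<in> A \<rightarrow> carrier F \<Longrightarrow> s \<odot> finsum F f A = finsum F (\<lambda>a. s \<odot> f a) A"
  by (rule hom_finsum) (simp_all add: smult_add)

lemma bdry_finsum:
  "f \<in> A \<rightarrow> carrier F \<Longrightarrow> \<partial> (finsum F f A) = finsum F (\<lambda>a. \<partial> (f a)) A"
  by (rule hom_finsum) (simp_all add: bdry_closed bdry_add)

lemma bicomp_subgroup: "additive_subgroup (bicomp F i u) F"
  using bigraded unfolding internal_direct_sum_def by force

lemma bicomp_carrier [simp, intro]: "x \<in> bicomp F i u \<Longrightarrow> x \<in> carrier F"
  using additive_subgroup.a_subset[OF bicomp_subgroup] by blast

lemma bicomp_zero [simp]: "\<zero> \<in> bicomp F i u"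
  by (rule additive_subgroup.zero_closed[OF bicomp_subgroup])

lemma bicomp_add: "\<lbrakk>x \<in> bicomp F i u; y \<in> bicomp F i u\<rbrakk> \<Longrightarrow> x \<oplus> y \<in> bicomp F i u"
  by (rule additive_subgroup.a_closed[OF bicomp_subgroup])

lemma bicomp_minus: "\<lbrakk>x \<in> bicomp F i u; y \<in> bicomp F i u\<rbrakk> \<Longrightarrow> x \<ominus> y \<in> bicomp F i u"
  by (simp add: a_minus_def bicomp_add additive_subgroup.a_inv_closed[OF bicomp_subgroup])

lemma bicomp_finsum:
  "(\<And>a. a \<in> A \<Longrightarrow> f a \<in> bicomp F i u) \<Longrightarrow> finsum F f A \<in> bicomp F i u"
proof (induction A rule: infinite_finite_induct)
  case (insert a A)
  then show ?case by (subst M.finsum_insert) (auto intro!: bicomp_add)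
qed simp_all

lemma xpow_bicomp:
  assumes "x \<in> bicomp F i u" shows "xpow a \<odot> x \<in> bicomp F i (u + mdeg a)"
  using smult_bicomp[OF homogeneous_xpow assms] by (simp add: add.commute)

definition component :: "'f \<Rightarrow> nat \<times> ('n \<Rightarrow> int) \<Rightarrow> 'f" where
  "component x = (THE f. (\<forall>d. f d \<in> (case d of (i, u) \<Rightarrow> bicomp F i u)) \<and>
     finite {d. f d \<noteq> \<zero>} \<and> x = finsum F f {d. f d \<noteq> \<zero>})"

lemma component:
  assumes "x \<in> carrier F"
  shows "component x (i, u) \<in> bicomp F i u" "finite {d. component x d \<noteq> \<zero>}"
    "finsum F (component x) {d. component x d \<noteq> \<zero>} = x"
proof -
  have "\<exists>!f. (\<forall>d. f d \<in> (case d of (i, u) \<Rightarrow> bicomp F i u)) \<and>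
      finite {d. f d \<noteq> \<zero>} \<and> x = finsum F f {d. f d \<noteq> \<zero>}"
    using bigraded assms unfolding internal_direct_sum_def by blast
  from theI'[OF this]
  have *: "(\<forall>d. component x d \<in> (case d of (i, u) \<Rightarrow> bicomp F i u)) \<and>
      finite {d. component x d \<noteq> \<zero>} \<and> x = finsum F (component x) {d. component x d \<noteq> \<zero>}"
    unfolding component_def .
  then have "component x (i, u) \<in> (case (i, u) of (i, u) \<Rightarrow> bicomp F i u)" by blast
  then show "component x (i, u) \<in> bicomp F i u" by simp
  show "finite {d. component x d \<noteq> \<zero>}"
    "finsum F (component x) {d. component x d \<noteq> \<zero>} = x"
    using * by auto
qed

lemma component_carrier [simp, intro]: "x \<in> carrier F \<Longrightarrow> component x d \<in> carrier F"
  by (cases d) (auto intro: component)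

lemma component_eqI:
  assumes f: "\<And>i u. f (i, u) \<in> bicomp F i u" and A: "finite A" "\<And>d. d \<notin> A \<Longrightarrow> f d = \<zero>"
  shows "component (finsum F f A) = f"
proof -
  have fc: "f d \<in> carrier F" for d
    using f by (cases d) auto
  have sub: "{d. f d \<noteq> \<zero>} \<subseteq> A" using A(2) by blast
  have sum: "finsum F f A = finsum F f {d. f d \<noteq> \<zero>}"
    using A(1) sub fc by (intro M.add.finprod_mono_neutral_cong_right) auto
  have fin: "finite {d. f d \<noteq> \<zero>}"
    using sub A(1) by (rule finite_subset)
  have f': "\<forall>d. f d \<in> (case d of (i, u) \<Rightarrow> bicomp F i u)"
    using f by auto
  have "finsum F f A \<in> carrier F"
    using fc by (intro M.finsum_closed) auto
  then have "\<exists>!g. (\<forall>d. g d \<in> (case d of (i, u) \<Rightarrow> bicomp F i u)) \<and>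
      finite {d. g d \<noteq> \<zero>} \<and> finsum F f A = finsum F g {d. g d \<noteq> \<zero>}"
    using bigraded unfolding internal_direct_sum_def by blast
  then show ?thesis
    unfolding component_def by (rule the1_equality) (simp add: f' fin sum)
qed

lemma component_homogeneous:
  assumes "x \<in> bicomp F i u"
  shows "component x d = (if d = (i, u) then x else \<zero>)"
proof -
  let ?f = "\<lambda>d. if d = (i, u) then x else \<zero>"
  have "component (finsum F ?f {(i, u)}) = ?f"
    by (rule component_eqI) (use assms in auto)
  then show ?thesis using assms by simp
qed

lemma component_zero [simp]: "component \<zero> d = \<zero>"
  using component_homogeneous[OF bicomp_zero] by simp

lemma component_add:
  assumes "x \<in> carrier F" "y \<in> carrier F"
  shows "component (x \<oplus> y) d = component x d \<oplus> component y d"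
proof -
  define A where "A = {d. component x d \<noteq> \<zero>} \<union> {d. component y d \<noteq> \<zero>}"
  have A: "finite A" using assms by (simp add: A_def component)
  have *: "finsum F (component z) A = z" if "z \<in> carrier F" "{d. component z d \<noteq> \<zero>} \<subseteq> A" for z
  proof -
    have "finsum F (component z) A = finsum F (component z) {d. component z d \<noteq> \<zero>}"
      using A that by (intro M.add.finprod_mono_neutral_cong_right) auto
    with component(3)[OF that(1)] show ?thesis by simp
  qed
  have "x \<oplus> y = finsum F (\<lambda>d. component x d \<oplus> component y d) A"
    using assms *[of x] *[of y] by (subst M.finsum_addf) (auto simp: A_def)
  moreover have "component (finsum F (\<lambda>d. component x d \<oplus> component y d) A) =
      (\<lambda>d. component x d \<oplus> component y d)"
    by (rule component_eqI) (use assms A in \<open>auto simp: A_def intro!: bicomp_add component\<close>)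
  ultimately show ?thesis by simp
qed

lemma component_finsum:
  "f \<in> A \<rightarrow> carrier F \<Longrightarrow> component (finsum F f A) d = finsum F (\<lambda>a. component (f a) d) A"
  by (rule hom_finsum) (simp_all add: component_add)

text \<open>By additivity \<open>h x\<close> is the sum of the images of the components of \<open>x\<close>, and only the one of
  bidegree \<open>d'\<close> contributes to bidegree \<open>d\<close>.\<close>

lemma component_hom:
  assumes closed: "\<And>x. x \<in> carrier F \<Longrightarrow> h x \<in> carrier F"
    and add: "\<And>x y. \<lbrakk>x \<in> carrier F; y \<in> carrier F\<rbrakk> \<Longrightarrow> h (x \<oplus> y) = h x \<oplus> h y"
    and shift: "\<And>i u y. y \<in> bicomp F i u \<Longrightarrow> component (h y) d = (if (i, u) = d' then h y else \<zero>)"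
    and x: "x \<in> carrier F"
  shows "component (h x) d = h (component x d')"
proof -
  let ?D = "insert d' {e. component x e \<noteq> \<zero>}"
  have fin: "finite ?D" using component(2)[OF x] by simp
  have "x = finsum F (component x) {e. component x e \<noteq> \<zero>}"
    using component(3)[OF x] by simp
  also have "\<dots> = finsum F (component x) ?D"
    using x fin by (intro M.add.finprod_mono_neutral_cong_left) auto
  finally have "h x = h (finsum F (component x) ?D)" by (rule arg_cong)
  also have "\<dots> = finsum F (\<lambda>e. h (component x e)) ?D"
    using x by (intro hom_finsum closed add) auto
  finally have "component (h x) d = finsum F (\<lambda>e. component (h (component x e)) d) ?D"
    using x closed by (subst component_finsum[symmetric]) auto
  also have "\<dots> = finsum F (\<lambda>e. if e = d' then h (component x e) else \<zero>) ?D"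
  proof (rule M.finsum_cong')
    show "component (h (component x e)) d = (if e = d' then h (component x e) else \<zero>)" for e
    proof (cases e)
      case (Pair i u)
      then show ?thesis using shift[OF component(1)[OF x, of i u]] by simp
    qed
    show "(\<lambda>e. if e = d' then h (component x e) else \<zero>) \<in> ?D \<rightarrow> carrier F"
      using x by (simp add: Pi_iff closed)
  qed simp
  also have "\<dots> = h (component x d')"
    using x closed fin by (intro M.add.finprod_singleton_swap) auto
  finally show ?thesis .
qed

lemma component_xpow:
  assumes "x \<in> carrier F"
  shows "component (xpow a \<odot> x) (i, u) = xpow a \<odot> component x (i, u - mdeg a)"
proof (rule component_hom)
  fix i' u' y assume "y \<in> bicomp F i' u'"
  from component_homogeneous[OF xpow_bicomp[OF this]]
  show "component (xpow a \<odot> y) (i, u) = (if (i', u') = (i, u - mdeg a) then xpow a \<odot> y else \<zero>)"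
    by (auto simp: fun_eq_iff algebra_simps)
qed (use assms smult_add in simp_all)

lemma component_bdry:
  assumes "x \<in> carrier F"
  shows "component (\<partial> x) (i, u) = \<partial> (component x (Suc i, u))"
proof (rule component_hom)
  fix i' u' y assume y: "y \<in> bicomp F i' u'"
  show "component (\<partial> y) (i, u) = (if (i', u') = (Suc i, u) then \<partial> y else \<zero>)"
  proof (cases i')
    case 0
    then show ?thesis using bdry_bicomp_0 y by simp
  next
    case (Suc k)
    then show ?thesis using component_homogeneous[OF bdry_bicomp_Suc] y by simp
  qed
qed (use assms bdry_closed bdry_add in simp_all)

lemma bicomp_hom_part: "bicomp F i u \<subseteq> hom_part F i"
proof
  fix x assume x: "x \<in> bicomp F i u"
  let ?f = "\<lambda>v. if v = u then x else \<zero>"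
  have "{v. ?f v \<noteq> \<zero>} \<subseteq> {u}" by auto
  then have fin: "finite {v. ?f v \<noteq> \<zero>}"
    by (rule finite_subset) simp
  have "finsum F ?f {v. ?f v \<noteq> \<zero>} = finsum F ?f {u}"
    using x by (intro M.add.finprod_mono_neutral_cong_left) auto
  also have "\<dots> = x" using x by simp
  finally show "x \<in> hom_part F i"
    unfolding hom_part_def using x fin by (intro CollectI exI[of _ ?f]) auto
qed

lemma hom_part_carrier: "hom_part F i \<subseteq> carrier F"
  by (auto simp: hom_part_def intro!: M.finsum_closed)

end

context multigraded_free_resolution
begin

definition basis :: "'f set" where
  "basis = (SOME B. free_basis F B)"

lemma basis: "free_basis F basis"
  unfolding basis_def using graded_free by (metis someI)

text \<open>Freeness enters only through the coordinate functions. They embed \<open>F\<close> into functions with values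
  in \<open>S\<close>, which shows that \<open>F\<close> is torsion-free and that the submodules \<open>\<mm>\<^sup>k F\<close> intersect in zero.\<close>

definition coord :: "'f \<Rightarrow> 'f \<Rightarrow> ('n, 'k) mpoly" where
  "coord x = (THE c. {b. c b \<noteq> 0} \<subseteq> basis \<and> finite {b. c b \<noteq> 0} \<and>
     x = finsum F (\<lambda>b. c b \<odot> b) {b. c b \<noteq> 0})"

lemma coord:
  assumes "x \<in> carrier F"
  shows "{b. coord x b \<noteq> 0} \<subseteq> basis" "finite {b. coord x b \<noteq> 0}"
    "finsum F (\<lambda>b. coord x b \<odot> b) {b. coord x b \<noteq> 0} = x"
proof -
  have "\<exists>!c. {b. c b \<noteq> 0} \<subseteq> basis \<and> finite {b. c b \<noteq> 0} \<and>
     x = finsum F (\<lambda>b. c b \<odot> b) {b. c b \<noteq> 0}"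
    using basis assms unfolding free_basis_def by blast
  from theI'[OF this, folded coord_def]
  show "{b. coord x b \<noteq> 0} \<subseteq> basis" "finite {b. coord x b \<noteq> 0}"
    "finsum F (\<lambda>b. coord x b \<odot> b) {b. coord x b \<noteq> 0} = x"
    by auto
qed

lemma basis_carrier: "b \<in> basis \<Longrightarrow> b \<in> carrier F"
  using basis by (auto simp: free_basis_def)

lemma coord_expansion:
  assumes "x \<in> carrier F" "finite A" "{b. coord x b \<noteq> 0} \<subseteq> A" "A \<subseteq> basis"
  shows "finsum F (\<lambda>b. coord x b \<odot> b) A = x"
proof -
  have "finsum F (\<lambda>b. coord x b \<odot> b) A = finsum F (\<lambda>b. coord x b \<odot> b) {b. coord x b \<noteq> 0}"
    using assms basis_carrier by (intro M.add.finprod_mono_neutral_cong_right) auto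
  with coord(3)[OF assms(1)] show ?thesis by simp
qed

lemma coord_eqI:
  assumes "finite A" "A \<subseteq> basis" "\<And>b. b \<notin> A \<Longrightarrow> c b = 0"
  shows "coord (finsum F (\<lambda>b. c b \<odot> b) A) = c"
proof -
  have sub: "{b. c b \<noteq> 0} \<subseteq> A" using assms(3) by blast
  have sum: "finsum F (\<lambda>b. c b \<odot> b) A = finsum F (\<lambda>b. c b \<odot> b) {b. c b \<noteq> 0}"
    using assms sub basis_carrier by (intro M.add.finprod_mono_neutral_cong_right) auto
  have "finsum F (\<lambda>b. c b \<odot> b) A \<in> carrier F"
    using assms(2) basis_carrier by (intro M.finsum_closed) auto
  then have "\<exists>!c'. {b. c' b \<noteq> 0} \<subseteq> basis \<and> finite {b. c' b \<noteq> 0} \<and>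
     finsum F (\<lambda>b. c b \<odot> b) A = finsum F (\<lambda>b. c' b \<odot> b) {b. c' b \<noteq> 0}"
    using basis unfolding free_basis_def by blast
  then show ?thesis
    unfolding coord_def
    by (rule the1_equality) (use sub assms in \<open>auto simp: sum intro: finite_subset\<close>)
qed

lemma coord_inject:
  assumes "x \<in> carrier F" "y \<in> carrier F" "coord x = coord y"
  shows "x = y"
  using coord(3)[OF assms(1)] unfolding assms(3) coord(3)[OF assms(2)] by (rule sym)

lemma coord_add [simp]:
  assumes "x \<in> carrier F" "y \<in> carrier F"
  shows "coord (x \<oplus> y) = coord x + coord y"
proof -
  define A where "A = {b. coord x b \<noteq> 0} \<union> {b. coord y b \<noteq> 0}"
  have A: "finite A" "A \<subseteq> basis"
    using assms coord by (auto simp: A_def)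
  have Ac: "b \<in> carrier F" if "b \<in> A" for b using that A(2) basis_carrier by blast
  have "finsum F (\<lambda>b. (coord x + coord y) b \<odot> b) A =
      finsum F (\<lambda>b. coord x b \<odot> b \<oplus> coord y b \<odot> b) A"
    using Ac by (intro M.finsum_cong') (auto simp: add_smult)
  also have "\<dots> = finsum F (\<lambda>b. coord x b \<odot> b) A \<oplus> finsum F (\<lambda>b. coord y b \<odot> b) A"
    using Ac by (intro M.finsum_addf) auto
  also have "\<dots> = x \<oplus> y"
    using coord_expansion[OF assms(1) A(1) _ A(2)] coord_expansion[OF assms(2) A(1) _ A(2)]
    by (simp add: A_def)
  finally show ?thesis
    using coord_eqI[OF A, of "coord x + coord y"] by (simp add: A_def)
qed

lemma coord_smult [simp]:
  assumes "x \<in> carrier F"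
  shows "coord (s \<odot> x) b = s * coord x b"
proof -
  define A where "A = {b. coord x b \<noteq> 0}"
  have A: "finite A" "A \<subseteq> basis"
    using assms coord by (auto simp: A_def)
  have Ac: "b \<in> carrier F" if "b \<in> A" for b using that A(2) basis_carrier by blast
  have "finsum F (\<lambda>b. (s * coord x b) \<odot> b) A = s \<odot> finsum F (\<lambda>b. coord x b \<odot> b) A"
    using Ac by (subst smult_finsum) (auto intro!: M.finsum_cong')
  also have "\<dots> = s \<odot> x"
    using coord(3)[OF assms] by (simp add: A_def)
  finally show ?thesis
    using coord_eqI[OF A, of "\<lambda>b. s * coord x b"] by (simp add: A_def)
qed

lemma coord_zero [simp]: "coord \<zero> b = 0"
  using coord_smult[of \<zero> 0 b] by simp

lemma coord_finsum [simp]: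
  "f \<in> A \<rightarrow> carrier F \<Longrightarrow> coord (finsum F f A) b = (\<Sum>a\<in>A. coord (f a) b)"
  by (induction A rule: infinite_finite_induct) auto

lemma eqI_coord:
  assumes "x \<in> carrier F" "y \<in> carrier F" "\<And>b. coord x b = coord y b"
  shows "x = y"
  by (rule coord_inject[OF assms(1,2) ext[OF assms(3)]])

lemma xpow_smult_cancel:
  assumes "x \<in> carrier F" "y \<in> carrier F" "xpow a \<odot> x = xpow a \<odot> y"
  shows "x = y"
proof (rule eqI_coord)
  fix b
  have "xpow a * coord x b = xpow a * coord y b"
    by (simp only: coord_smult[OF assms(1), symmetric] coord_smult[OF assms(2), symmetric] assms(3))
  then show "coord x b = coord y b" by (rule xpow_mult_cancel)
qed (use assms in simp_all)

end

section \<open>Lifting along boundaries\<close>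

lemma diff_mdeg_le: "u - mdeg a \<le> u"
  by (simp add: le_fun_def)

lemma sum_mdeg_exp_unit [simp]: "sum (mdeg (exp_unit l)) (UNIV :: 'n::finite set) = 1"
proof -
  have eq: "mdeg (exp_unit l) = (\<lambda>j. if j = l then 1 else 0)" by (simp add: fun_eq_iff)
  show ?thesis unfolding eq by simp
qed

context multigraded_free_resolution
begin

lemma bdry_zero [simp]: "\<partial> \<zero> = \<zero>"
  using bdry_bicomp_0[OF bicomp_zero] .

lemma one_carrier [simp]: "\<one> \<in> carrier F"
  using one_bicomp by blast

lemma smult_one_inject: "s \<odot> \<one> = t \<odot> \<one> \<longleftrightarrow> s = t"
  using hom_part_0 by (auto simp: bij_betw_def inj_on_def)

lemma single_one_bicomp: "Poly_Mapping.single a c \<odot> \<one> \<in> bicomp F 0 (mdeg a)"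
  using smult_bicomp[OF homogeneous_single one_bicomp, of a c] by simp

lemma sum_smult: "x \<in> carrier F \<Longrightarrow> (\<Sum>a\<in>A. f a) \<odot> x = finsum F (\<lambda>a. f a \<odot> x) A"
  by (induction A rule: infinite_finite_induct) (auto simp: add_smult)

text \<open>\<open>F\<^sub>0 = S\<close> also as a multigraded module: the bijection \<open>s \<mapsto> s \<odot> \<one>\<close> respects degrees, so comparing
  components isolates a single term of \<open>s\<close>.\<close>

lemma bicomp_0_cases:
  assumes "x \<in> bicomp F 0 u"
  obtains "x = \<zero>" | a c where "u = mdeg a" "c \<noteq> 0" "x = Poly_Mapping.single a c \<odot> \<one>"
proof (cases "x = \<zero>")
  case False
  obtain s where s: "x = s \<odot> \<one>"
    using assms bicomp_hom_part[of 0 u] bij_betw_imp_surj_on[OF hom_part_0] by blast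
  let ?m = "\<lambda>a. Poly_Mapping.single a (Poly_Mapping.lookup s a) \<odot> \<one>"
  have "s \<odot> \<one> = finsum F ?m (Poly_Mapping.keys s)"
    by (subst poly_mapping_eq_sum_single[of s]) (simp add: sum_smult)
  then have "x = component (finsum F ?m (Poly_Mapping.keys s)) (0, u)"
    using component_homogeneous[OF assms, of "(0, u)"] s by simp
  also have "\<dots> = finsum F (\<lambda>a. component (?m a) (0, u)) (Poly_Mapping.keys s)"
    by (intro component_finsum) auto
  also have "\<dots> = finsum F (\<lambda>a. if u = mdeg a then ?m a else \<zero>) (Poly_Mapping.keys s)"
    by (intro M.finsum_cong') (auto simp: component_homogeneous[OF single_one_bicomp])
  finally have x: "x = finsum F (\<lambda>a. if u = mdeg a then ?m a else \<zero>) (Poly_Mapping.keys s)" .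
  have "\<exists>a\<in>Poly_Mapping.keys s. u = mdeg a"
  proof (rule ccontr)
    assume "\<not> ?thesis"
    then have "finsum F (\<lambda>a. if u = mdeg a then ?m a else \<zero>) (Poly_Mapping.keys s) = \<zero>"
      by (intro M.add.finprod_one_eqI) auto
    with x False show False by simp
  qed
  then obtain a where a: "a \<in> Poly_Mapping.keys s" "u = mdeg a" by blast
  have "(u = mdeg b) = (b = a)" for b
    using a(2) by (auto simp: fun_eq_iff)
  then have "x = finsum F (\<lambda>b. if b = a then ?m b else \<zero>) (Poly_Mapping.keys s)"
    using x by simp
  also have "\<dots> = ?m a"
    using a(1) by (intro M.add.finprod_singleton_swap) auto
  finally show thesis
    using that(2)[OF a(2)] a(1) by (auto simp: in_keys_iff)
qed (rule that(1))

lemma bdry_bicomp_1: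
  assumes "x \<in> bicomp F 1 u" obtains s where "s \<in> I" "\<partial> x = s \<odot> \<one>"
  using assms exact_0 bicomp_hom_part by blast

text \<open>Exactness is assumed for the modules \<open>F\<^sub>i\<close>. It passes to each multidegree, because the component
  of a preimage is again a preimage.\<close>

lemma ideal_lift:
  assumes "s \<in> I" "s \<odot> \<one> \<in> bicomp F 0 u"
  obtains z where "z \<in> bicomp F 1 u" "\<partial> z = s \<odot> \<one>"
proof -
  obtain w where w: "w \<in> hom_part F 1" "\<partial> w = s \<odot> \<one>"
    using assms(1) exact_0 by (metis (no_types, lifting) image_iff)
  then have wc: "w \<in> carrier F" using hom_part_carrier by blast
  have "\<partial> (component w (1, u)) = component (\<partial> w) (0, u)"
    using component_bdry[OF wc, of 0 u] by simp
  also have "\<dots> = s \<odot> \<one>"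
    using component_homogeneous[OF assms(2)] w(2) by simp
  finally show thesis
    using that component(1)[OF wc] by blast
qed

lemma cycle_lift:
  assumes "x \<in> bicomp F (Suc i) u" "\<partial> x = \<zero>"
  obtains w where "w \<in> bicomp F (Suc (Suc i)) u" "\<partial> w = x"
proof -
  obtain w where w: "w \<in> hom_part F (Suc (Suc i))" "\<partial> w = x"
    using exact_Suc[OF _ assms(2), of i] assms(1) bicomp_hom_part by blast
  then have wc: "w \<in> carrier F" using hom_part_carrier by blast
  have "\<partial> (component w (Suc (Suc i), u)) = component (\<partial> w) (Suc i, u)"
    using component_bdry[OF wc] by simp
  also have "\<dots> = x"
    using component_homogeneous[OF assms(1)] w(2) by simp
  finally show thesis
    using that component(1)[OF wc] by blast
qed

end

context minimal_multigraded_free_resolution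
begin

lemma xvar_bicomp:
  "x \<in> bicomp F i (u - mdeg (exp_unit l)) \<Longrightarrow> xvar l \<odot> x \<in> bicomp F i u"
  using xpow_bicomp[of x i "u - mdeg (exp_unit l)" "exp_unit l"] by (simp add: xvar_def)

text \<open>By exactness two elements with the same boundary differ by a boundary, and by minimality a
  boundary lies in \<open>\<mm> F\<close>. This is the step on which all inductions below rest.\<close>

lemma same_bdry:
  assumes x: "x \<in> bicomp F (Suc i) u" and z: "z \<in> bicomp F (Suc i) u" and eq: "\<partial> x = \<partial> z"
  obtains f where "\<And>l. f l \<in> bicomp F (Suc i) (u - mdeg (exp_unit l))"
    "x = z \<oplus> finsum F (\<lambda>l. xvar l \<odot> f l) UNIV"
proof -
  have d: "x \<ominus> z \<in> bicomp F (Suc i) u"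
    using x z by (rule bicomp_minus)
  have "(x \<ominus> z) \<oplus> z = x"
    using x z by (auto simp: a_minus_def M.a_assoc M.l_neg)
  then have "\<partial> x = \<partial> (x \<ominus> z) \<oplus> \<partial> z"
    using bdry_add[of "x \<ominus> z" z] x z d by (metis bicomp_carrier)
  then have "\<partial> (x \<ominus> z) = \<zero>"
    using x z d eq bdry_closed by (metis M.add.r_cancel_one' bicomp_carrier)
  then obtain w where w: "w \<in> bicomp F (Suc (Suc i)) u" "\<partial> w = x \<ominus> z"
    using cycle_lift[OF d] by blast
  obtain f where f: "range f \<subseteq> carrier F" "\<partial> w = finsum F (\<lambda>l. xvar l \<odot> f l) UNIV"
    using minimal w(1) by blast
  define g where "g l = component (f l) (Suc i, u - mdeg (exp_unit l))" for l
  have fc: "f l \<in> carrier F" for l using f(1) by blast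
  have "x \<ominus> z = component (finsum F (\<lambda>l. xvar l \<odot> f l) UNIV) (Suc i, u)"
    using component_homogeneous[OF d, of "(Suc i, u)"] f(2) w(2) by simp
  also have "\<dots> = finsum F (\<lambda>l. component (xvar l \<odot> f l) (Suc i, u)) UNIV"
    using fc by (intro component_finsum) auto
  also have "\<dots> = finsum F (\<lambda>l. xvar l \<odot> g l) UNIV"
    using fc component(1)[OF fc] by (intro M.finsum_cong') (auto simp: xvar_def g_def component_xpow)
  finally have "x \<ominus> z = finsum F (\<lambda>l. xvar l \<odot> g l) UNIV" .
  moreover have "x = z \<oplus> (x \<ominus> z)"
    using x z d \<open>(x \<ominus> z) \<oplus> z = x\<close> by (metis M.a_comm bicomp_carrier)
  ultimately show thesis
    using that[of g] component(1)[OF fc] by (simp add: g_def)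
qed

lemma cycle_decomposition:
  assumes "x \<in> bicomp F (Suc i) u" "\<partial> x = \<zero>"
  obtains f where "\<And>l. f l \<in> bicomp F (Suc i) (u - mdeg (exp_unit l))"
    "x = finsum F (\<lambda>l. xvar l \<odot> f l) UNIV"
proof -
  obtain f where f: "\<And>l. f l \<in> bicomp F (Suc i) (u - mdeg (exp_unit l))"
    "x = \<zero> \<oplus> finsum F (\<lambda>l. xvar l \<odot> f l) UNIV"
    using same_bdry[OF assms(1) bicomp_zero] assms(2) by auto
  then have "finsum F (\<lambda>l. xvar l \<odot> f l) UNIV \<in> carrier F"
    by (intro M.finsum_closed) auto
  with f(2) have "x = finsum F (\<lambda>l. xvar l \<odot> f l) UNIV" by simp
  with f(1) show thesis by (rule that)
qed

text \<open>If everything in the degrees of a down-closed set \<open>D\<close> is a cycle, then every element of such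
  a degree lies in \<open>\<mm> F\<close>, with coefficients in degrees of \<open>D\<close> again, hence in all powers
  \<open>\<mm>\<^sup>k F\<close>. These intersect in zero since \<open>F\<close> is free.\<close>

lemma vanishing_if_cycles:
  assumes D: "\<And>u l. u \<in> D \<Longrightarrow> u - mdeg (exp_unit l) \<in> D"
    and cyc: "\<And>u x. \<lbrakk>u \<in> D; x \<in> bicomp F (Suc i) u\<rbrakk> \<Longrightarrow> \<partial> x = \<zero>"
    and "u \<in> D" "x \<in> bicomp F (Suc i) u"
  shows "x = \<zero>"
proof (rule eqI_coord)
  \<comment> \<open>\<open>x\<close> lies in \<open>\<mm>\<^sup>k F\<close>, stated for the monomials that occur in its coordinates\<close>
  have adic: "k \<le> sum a UNIV"
    if "u \<in> D" "x \<in> bicomp F (Suc i) u" "a \<in> Poly_Mapping.keys (coord x b)" for k u x a b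
    using that
  proof (induction k arbitrary: u x a)
    case (Suc k)
    obtain f where f: "\<And>l. f l \<in> bicomp F (Suc i) (u - mdeg (exp_unit l))"
      "x = finsum F (\<lambda>l. xvar l \<odot> f l) UNIV"
      using cycle_decomposition[OF Suc.prems(2)] cyc[OF Suc.prems(1,2)] by blast
    then have "coord x b = (\<Sum>l\<in>UNIV. xvar l * coord (f l) b)"
      by (subst f(2), subst coord_finsum) (auto intro!: sum.cong coord_smult)
    then have "(\<Sum>l\<in>UNIV. Poly_Mapping.lookup (xvar l * coord (f l) b) a) \<noteq> 0"
      using Suc.prems(3) by (simp add: in_keys_iff lookup_sum)
    then obtain l where "Poly_Mapping.lookup (xvar l * coord (f l) b) a \<noteq> 0"
      by (metis (no_types, lifting) sum.neutral)
    then have l: "exp_unit l \<le> a" "a - exp_unit l \<in> Poly_Mapping.keys (coord (f l) b)"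
      by (auto simp: xvar_def lookup_xpow_mult in_keys_iff split: if_splits)
    have "k \<le> sum (a - exp_unit l) UNIV"
      by (rule Suc.IH[OF D[OF Suc.prems(1)] f(1) l(2)])
    moreover have "sum a UNIV = sum (a - exp_unit l) UNIV + sum (exp_unit l) UNIV"
      using l(1) by (subst sum.distrib[symmetric]) (auto simp: le_fun_def intro!: sum.cong)
    ultimately show ?case by simp
  qed simp
  have "Poly_Mapping.keys (coord x b) = {}" for b
  proof (rule ccontr)
    assume "Poly_Mapping.keys (coord x b) \<noteq> {}"
    then obtain a where "a \<in> Poly_Mapping.keys (coord x b)" by blast
    from adic[OF assms(3,4) this, of "Suc (sum a UNIV)"] show False by simp
  qed
  then show "coord x b = coord \<zero> b" for b
    by simp
qed (use assms in auto)

end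


section \<open>Divisibility in a minimal resolution of a squarefree monomial ideal\<close>

locale squarefree_resolution =
  minimal_multigraded_free_resolution I F + squarefree_ideal I
  for I :: "('n::finite, 'k::field) mpoly set" and F :: "('n, 'k, 'f) mdga" (structure)
begin

lemma no_gen_below_diff:
  assumes "\<not> (\<exists>m\<in>G. mdeg m \<le> u)" shows "\<not> (\<exists>m\<in>G. mdeg m \<le> u - mdeg a)"
proof
  assume "\<exists>m\<in>G. mdeg m \<le> u - mdeg a"
  then obtain m where m: "m \<in> G" "mdeg m \<le> u - mdeg a" by blast
  from m(2) diff_mdeg_le[of u a] have "mdeg m \<le> u" by (rule order.trans)
  with m(1) assms show False by blast
qed

lemma no_gen_below_negative:
  assumes "u j < 0" shows "\<not> (\<exists>m\<in>G. mdeg m \<le> u)"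
proof
  assume "\<exists>m\<in>G. mdeg m \<le> u"
  then obtain m where "mdeg m \<le> u" by blast
  from le_funD[OF this, of j] assms show False by simp
qed

text \<open>In a degree that no generator divides, \<open>I\<close> contains only zero, so that \<open>F\<^sub>1\<close> consists of
  cycles and vanishes. The same then holds for \<open>F\<^sub>2\<close>, \<open>F\<^sub>3\<close>, and so on.\<close>

lemma bicomp_eq_zero:
  assumes "x \<in> bicomp F (Suc i) u" "\<not> (\<exists>m\<in>min_gens I. mdeg m \<le> u)"
  shows "x = \<zero>"
  using assms
proof (induction i arbitrary: u x)
  case 0
  show ?case
  proof (rule vanishing_if_cycles[where D = "{u. \<not> (\<exists>m\<in>min_gens I. mdeg m \<le> u)}"])
    show "u - mdeg (exp_unit l) \<in> {u. \<not> (\<exists>m\<in>min_gens I. mdeg m \<le> u)}"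
      if "u \<in> {u. \<not> (\<exists>m\<in>min_gens I. mdeg m \<le> u)}" for u l
      using that unfolding mem_Collect_eq by (rule no_gen_below_diff)
  next
    fix u x assume u: "u \<in> {u. \<not> (\<exists>m\<in>min_gens I. mdeg m \<le> u)}" and x: "x \<in> bicomp F (Suc 0) u"
    obtain s where s: "s \<in> I" "\<partial> x = s \<odot> \<one>"
      using bdry_bicomp_1 x by (metis One_nat_def)
    from bdry_bicomp_Suc[OF x] show "\<partial> x = \<zero>"
    proof (cases rule: bicomp_0_cases)
      case (2 a c)
      then have "xpow a \<in> I"
        using s single_mem_ideal smult_one_inject by metis
      then obtain m where "m \<in> min_gens I" "m \<le> a"
        by (rule min_gen_divisor)
      with u 2(1) show ?thesis by (auto simp: le_fun_def)
    qed
  qed (use 0 in simp_all)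
next
  case (Suc i)
  show ?case
  proof (rule vanishing_if_cycles[where D = "{u. \<not> (\<exists>m\<in>min_gens I. mdeg m \<le> u)}"])
    show "\<partial> x = \<zero>"
      if "u \<in> {u. \<not> (\<exists>m\<in>min_gens I. mdeg m \<le> u)}" "x \<in> bicomp F (Suc (Suc i)) u" for u x
      using Suc.IH[OF bdry_bicomp_Suc[OF that(2)]] that(1) by simp
    show "u - mdeg (exp_unit l) \<in> {u. \<not> (\<exists>m\<in>min_gens I. mdeg m \<le> u)}"
      if "u \<in> {u. \<not> (\<exists>m\<in>min_gens I. mdeg m \<le> u)}" for u l
      using that unfolding mem_Collect_eq by (rule no_gen_below_diff)
  qed (use Suc.prems in simp_all)
qed

lemma min_gen_below:
  assumes "m \<in> min_gens I"
  shows "\<not> (\<exists>m'\<in>min_gens I. mdeg m' \<le> mdeg m - mdeg (exp_unit l))"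
proof
  assume "\<exists>m'\<in>min_gens I. mdeg m' \<le> mdeg m - mdeg (exp_unit l)"
  then obtain m' where m': "m' \<in> min_gens I" "\<And>j. int (m' j) \<le> int (m j) - int (exp_unit l j)"
    by (auto simp: le_fun_def)
  have "m' j \<le> m j" for j using m'(2)[of j] by simp
  then have "m' = m"
    using assms m'(1) by (auto simp: min_gens_def le_fun_def)
  with m'(2)[of l] show False by simp
qed

text \<open>In the degrees properly below \<open>m\<close> everything of positive homological degree vanishes, so by
  minimality there are no cycles in degree \<open>m\<close> but zero. An element of \<open>F\<^sub>2\<close> of this degree has such
  a cycle as its boundary and is therefore a cycle itself.\<close>

lemma bicomp_2_min_gen:
  assumes m: "m \<in> min_gens I" and x: "x \<in> bicomp F 2 (mdeg m)"
  shows "x = \<zero>"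
proof -
  have cycle: "x = \<zero>" if x: "x \<in> bicomp F (Suc i) (mdeg m)" "\<partial> x = \<zero>" for x i
  proof -
    obtain f where f: "\<And>l. f l \<in> bicomp F (Suc i) (mdeg m - mdeg (exp_unit l))"
      "x = finsum F (\<lambda>l. xvar l \<odot> f l) UNIV"
      using cycle_decomposition[OF x] by blast
    have "f l = \<zero>" for l
      using bicomp_eq_zero[OF f(1) min_gen_below[OF m]] .
    with f(2) show ?thesis by simp
  qed
  have x': "x \<in> bicomp F (Suc 1) (mdeg m)" using x by (simp add: numeral_2_eq_2)
  have "\<partial> x = \<zero>"
    using cycle[of "\<partial> x" 0] bdry_bicomp_Suc[OF x'] bdry_bdry[of x] x by (simp add: bicomp_carrier)
  with cycle x' show ?thesis by blast
qed

text \<open>A graded form of Nakayama's lemma: to show that homogeneous subgroups \<open>N u\<close> that are closed under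
  the variables exhaust \<open>F\<^sub>i\<^sub>+\<^sub>1\<close>, it suffices to realise all boundaries by elements of them. The
  error is in \<open>\<mm> F\<close> and is removed by induction on the total degree, which starts because \<open>F\<^sub>i\<^sub>+\<^sub>1\<close>
  vanishes in degrees with a negative entry.\<close>

lemma graded_nakayama:
  assumes sub: "\<And>u. N u \<subseteq> bicomp F (Suc i) u"
    and zero: "\<And>u. \<zero> \<in> N u"
    and add: "\<And>u x y. \<lbrakk>x \<in> N u; y \<in> N u\<rbrakk> \<Longrightarrow> x \<oplus> y \<in> N u"
    and var: "\<And>u l x. x \<in> N (u - mdeg (exp_unit l)) \<Longrightarrow> xvar l \<odot> x \<in> N u"
    and lift: "\<And>u x. x \<in> bicomp F (Suc i) u \<Longrightarrow> \<exists>z\<in>N u. \<partial> x = \<partial> z"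
    and x: "x \<in> bicomp F (Suc i) u"
  shows "x \<in> N u"
  using x
proof (induction "nat (sum u UNIV)" arbitrary: u x rule: less_induct)
  case less
  show ?case
  proof (cases "\<exists>m\<in>min_gens I. mdeg m \<le> u")
    case False
    then show ?thesis using bicomp_eq_zero[OF less.prems] zero by simp
  next
    case True
    then have u: "0 \<le> u j" for j
      using no_gen_below_negative[of u j "min_gens I"] by force
    obtain z where z: "z \<in> N u" "\<partial> x = \<partial> z"
      using lift[OF less.prems] by blast
    obtain f where f: "\<And>l. f l \<in> bicomp F (Suc i) (u - mdeg (exp_unit l))"
      "x = z \<oplus> finsum F (\<lambda>l. xvar l \<odot> f l) UNIV"
      using same_bdry[OF less.prems _ z(2)] z(1) sub by blast
    \<comment> \<open>the total degree drops, except that a degree with a negative entry may be reached\<close>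
    have "f l \<in> N (u - mdeg (exp_unit l))" for l
    proof (cases "u l = 0")
      case True
      then have "(u - mdeg (exp_unit l)) l < 0" by simp
      then have "\<not> (\<exists>m\<in>min_gens I. mdeg m \<le> u - mdeg (exp_unit l))"
        by (rule no_gen_below_negative)
      from bicomp_eq_zero[OF f(1) this] zero show ?thesis by simp
    next
      case False
      have "sum (u - mdeg (exp_unit l)) UNIV = sum u UNIV - 1"
        by (simp add: sum_subtractf)
      moreover have "u l \<le> sum u UNIV"
        using u by (intro member_le_sum) auto
      ultimately have "nat (sum (u - mdeg (exp_unit l)) UNIV) < nat (sum u UNIV)"
        using False u[of l] by linarith
      from less.hyps[OF this f(1)] show ?thesis .
    qed
    then have "xvar l \<odot> f l \<in> N u" for l by (rule var)
    then have "finsum F (\<lambda>l. xvar l \<odot> f l) A \<in> N u" for A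
    proof (induction A rule: infinite_finite_induct)
      case (insert l A)
      then have "xvar l \<odot> f l \<oplus> finsum F (\<lambda>l. xvar l \<odot> f l) A \<in> N u"
        using add by blast
      then show ?case
        using insert.hyps f(1) by (subst M.finsum_insert) auto
    qed (simp_all add: zero)
    with f(2) z(1) add show ?thesis by blast
  qed
qed

text \<open>By induction on the homological degree. The boundary of an element of degree \<open>u + e\<^sub>j\<close> is divisible by
  \<open>x\<^sub>j\<close>, and the quotient is again a boundary: it is a cycle, or, in homological degree zero, it lies in
  \<open>I\<close> because \<open>I\<close> is squarefree. So all boundaries are realised by multiples of \<open>x\<^sub>j\<close>, and
  \<open>graded_nakayama\<close> applies.\<close>

lemma divisible_by_var:
  assumes "x \<in> bicomp F i (u + mdeg (exp_unit j))" "1 \<le> u j"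
  obtains y where "y \<in> bicomp F i u" "x = xvar j \<odot> y"
proof -
  have "\<exists>y\<in>bicomp F i u. x = xvar j \<odot> y"
    using assms
  proof (induction i arbitrary: u x)
    case 0
    from 0(1) show ?case
    proof (cases rule: bicomp_0_cases)
      case 1
      then show ?thesis by (intro bexI[of _ \<zero>]) simp_all
    next
      case (2 a c)
      have eq: "int (a i) = u i + int (exp_unit j i)" for i
        using fun_cong[OF 2(1), of i] by simp
      have j: "exp_unit j i \<le> a i" for i
        using eq[of i] 0(2) by (cases "i = j") auto
      have u: "mdeg (a - exp_unit j) = u"
      proof
        show "int ((a - exp_unit j) i) = u i" for i
          using eq[of i] j[of i] by (cases "i = j") auto
      qed
      have "exp_unit j + (a - exp_unit j) = a"
        using j by (simp add: fun_eq_iff)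
      then have "xvar j * Poly_Mapping.single (a - exp_unit j) c = Poly_Mapping.single a c"
        by (simp add: xvar_def xpow_mult_single)
      with 2(3) single_one_bicomp[of "a - exp_unit j" c] show ?thesis
        unfolding u by (intro bexI[of _ "Poly_Mapping.single (a - exp_unit j) c \<odot> \<one>"]) simp_all
    qed
  next
    case (Suc i)
    \<comment> \<open>in degrees without divisibility claim \<open>N v\<close> is everything, so that \<open>N\<close> is closed under all variables\<close>
    define N where "N v = {x \<in> bicomp F (Suc i) v. 2 \<le> v j \<longrightarrow>
      (\<exists>y\<in>bicomp F (Suc i) (v - mdeg (exp_unit j)). x = xvar j \<odot> y)}" for v
    have "x \<in> N (u + mdeg (exp_unit j))"
    proof (rule graded_nakayama[where i = i])
      show "N v \<subseteq> bicomp F (Suc i) v" for v by (auto simp: N_def)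
      show "\<zero> \<in> N v" for v
        unfolding N_def by (intro CollectI conjI impI bexI[of _ \<zero>]) simp_all
      show "x \<oplus> y \<in> N v" if "x \<in> N v" "y \<in> N v" for v x y
      proof -
        have "\<exists>z\<in>bicomp F (Suc i) (v - mdeg (exp_unit j)). x \<oplus> y = xvar j \<odot> z" if v: "2 \<le> v j"
        proof -
          obtain x' y' where *: "x' \<in> bicomp F (Suc i) (v - mdeg (exp_unit j))" "x = xvar j \<odot> x'"
            "y' \<in> bicomp F (Suc i) (v - mdeg (exp_unit j))" "y = xvar j \<odot> y'"
            using \<open>x \<in> N v\<close> \<open>y \<in> N v\<close> v by (auto simp: N_def)
          then have "x \<oplus> y = xvar j \<odot> (x' \<oplus> y')"
            by (simp add: smult_add bicomp_carrier)
          with bicomp_add[OF *(1,3)] show ?thesis by blast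
        qed
        with that show ?thesis by (simp add: N_def bicomp_add)
      qed
      show "xvar l \<odot> x \<in> N v" if x: "x \<in> N (v - mdeg (exp_unit l))" for v l x
      proof -
        have xc: "x \<in> bicomp F (Suc i) (v - mdeg (exp_unit l))"
          using x by (simp add: N_def)
        have "\<exists>y\<in>bicomp F (Suc i) (v - mdeg (exp_unit j)). xvar l \<odot> x = xvar j \<odot> y" if v: "2 \<le> v j"
        proof (cases "l = j")
          case True
          then show ?thesis using xc by blast
        next
          case False
          then obtain y where y: "x = xvar j \<odot> y"
            "y \<in> bicomp F (Suc i) (v - mdeg (exp_unit l) - mdeg (exp_unit j))"
            using x v by (auto simp: N_def)
          have "v - mdeg (exp_unit l) - mdeg (exp_unit j) = v - mdeg (exp_unit j) - mdeg (exp_unit l)"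
            by (simp add: algebra_simps)
          with y(2) have "xvar l \<odot> y \<in> bicomp F (Suc i) (v - mdeg (exp_unit j))"
            by (metis xvar_bicomp)
          moreover have "xvar l \<odot> x = xvar j \<odot> (xvar l \<odot> y)"
            using y by (simp add: mult.commute bicomp_carrier)
          ultimately show ?thesis by blast
        qed
        with xvar_bicomp[OF xc] show ?thesis by (simp add: N_def)
      qed
      show "\<exists>z\<in>N v. \<partial> x = \<partial> z" if x: "x \<in> bicomp F (Suc i) v" for v x
      proof (cases "2 \<le> v j")
        case False
        with x show ?thesis by (auto simp: N_def)
      next
        case True
        let ?w = "v - mdeg (exp_unit j)"
        have w: "?w + mdeg (exp_unit j) = v" "1 \<le> ?w j" using True by simp_all
        have "\<partial> x \<in> bicomp F i (?w + mdeg (exp_unit j))"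
          unfolding w(1) by (rule bdry_bicomp_Suc[OF x])
        from Suc.IH[OF this w(2)] obtain y where y: "y \<in> bicomp F i ?w" "\<partial> x = xvar j \<odot> y"
          by blast
        obtain z where z: "z \<in> bicomp F (Suc i) ?w" "\<partial> z = y"
        proof (cases i)
          case 0
          obtain s where s: "s \<in> I" "\<partial> x = s \<odot> \<one>"
            using bdry_bicomp_1 x 0 by (metis One_nat_def)
          from y(1) 0 have "y \<in> bicomp F 0 ?w" by simp
          then show ?thesis
          proof (cases rule: bicomp_0_cases)
            case 1
            then show ?thesis using that[of \<zero>] by simp
          next
            case (2 a c)
            have "s = xvar j * Poly_Mapping.single a c"
              using s(2) y(2) 2(3) by (simp add: smult_one_inject)
            then have "Poly_Mapping.single (exp_unit j + a) c \<in> I"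
              using s(1) by (simp add: xvar_def xpow_mult_single)
            then obtain b
              where b: "xpow b \<in> I" "b \<le> exp_unit j + a" "\<And>l. b l \<le> 1"
              using squarefree_divisor[OF single_mem_ideal[OF _ 2(2)]] by blast
            have "1 \<le> a j" using w(2) fun_cong[OF 2(1), of j] by simp
            have "b l \<le> a l" for l
              using le_funD[OF b(2), of l] b(3)[of l] \<open>1 \<le> a j\<close> by (cases "l = j") auto
            then have "Poly_Mapping.single a c \<in> I"
              using xpow_mem_mono[OF b(1)] by (simp add: le_fun_def)
            then obtain z where "z \<in> bicomp F 1 ?w" "\<partial> z = y"
              using ideal_lift[of "Poly_Mapping.single a c" ?w] 2(3) \<open>y \<in> bicomp F 0 ?w\<close> by auto
            then show ?thesis using that 0 by simp
          qed
        next
          case (Suc k)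
          have "xvar j \<odot> \<partial> y = xvar j \<odot> \<zero>"
            using bdry_smult[of y "xvar j"] y bdry_bdry[of x] x by (auto simp: bicomp_carrier)
          then have "\<partial> y = \<zero>"
            using xpow_smult_cancel y(1) bdry_closed unfolding xvar_def
            by (metis M.zero_closed bicomp_carrier)
          then show ?thesis
            using cycle_lift[of y k ?w] y(1) that Suc by auto
        qed
        have "\<partial> (xvar j \<odot> z) = \<partial> x"
          using bdry_smult[of z "xvar j"] z y(2) by (auto simp: bicomp_carrier)
        moreover have "xvar j \<odot> z \<in> N v"
          using xvar_bicomp[OF z(1)] z(1) by (auto simp: N_def)
        ultimately show ?thesis by metis
      qed
    qed (use Suc.prems(1) in simp)
    with Suc.prems(2) show ?case by (simp add: N_def)
  qed
  with that show thesis by blast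
qed

lemma divisible_by_xpow:
  assumes "x \<in> bicomp F i (u + mdeg a)" "\<And>j. 0 < a j \<Longrightarrow> 1 \<le> u j"
  obtains y where "y \<in> bicomp F i u" "x = xpow a \<odot> y"
  using assms
proof (induction "sum a UNIV" arbitrary: a x thesis)
  case 0
  then have "a = (\<lambda>_. 0)" by (simp add: fun_eq_iff)
  moreover have "u + mdeg (\<lambda>_. 0) = u" by (simp add: fun_eq_iff)
  ultimately show ?case using 0(2)[of x] 0(3) by (simp add: bicomp_carrier)
next
  case (Suc k)
  have "\<exists>j. 0 < a j"
  proof (rule ccontr)
    assume "\<not> ?thesis"
    then have "sum a UNIV = 0" by simp
    with Suc.hyps(2) show False by simp
  qed
  then obtain j where j: "0 < a j" by blast
  define b where "b = a - exp_unit j"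
  have le: "exp_unit j i \<le> a i" for i using j by simp
  have a: "a = b + exp_unit j" unfolding b_def using le by (simp add: fun_eq_iff)
  have "sum a UNIV = sum b UNIV + sum (exp_unit j) UNIV"
    by (subst a, subst sum.distrib[symmetric]) simp
  with Suc.hyps(2) have k: "k = sum b UNIV" by simp
  have "u + mdeg a = (u + mdeg b) + mdeg (exp_unit j)"
    by (subst a) (simp add: fun_eq_iff)
  with Suc.prems(2) have x: "x \<in> bicomp F i ((u + mdeg b) + mdeg (exp_unit j))" by metis
  have "1 \<le> (u + mdeg b) j"
    using Suc.prems(3)[OF j] by simp
  with x obtain y where y: "y \<in> bicomp F i (u + mdeg b)" "x = xvar j \<odot> y"
    by (rule divisible_by_var)
  have "1 \<le> u i" if "0 < b i" for i
    using that Suc.prems(3)[of i] by (simp add: b_def split: if_splits)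
  with Suc.hyps(1)[OF k _ y(1)] obtain z where z: "z \<in> bicomp F i u" "y = xpow b \<odot> z"
    by blast
  have "xpow a = xvar j * (xpow b :: ('n, 'k) mpoly)"
    unfolding a xvar_def xpow_add by (rule mult.commute)
  then have "x = xpow a \<odot> z"
    using y(2) z by (simp add: bicomp_carrier)
  with z(1) Suc.prems(1) show ?case by blast
qed

end

section \<open>The Taylor algebra\<close>

lemma lookup_map_times [simp]:
  "Poly_Mapping.lookup (Poly_Mapping.map ((*) s) t) W = s * Poly_Mapping.lookup t (W :: 'a) "
  for s :: "'b::comm_ring_1"
  by (simp add: Poly_Mapping.map.rep_eq when_def)

lemma poly_mapping_eq_sum_superset:
  assumes "finite A" "Poly_Mapping.keys t \<subseteq> A"
  shows "t = (\<Sum>W\<in>A. Poly_Mapping.single W (Poly_Mapping.lookup t W))"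
  by (subst poly_mapping_eq_sum_single, rule sum.mono_neutral_left)
    (use assms in \<open>auto simp: not_in_keys_iff_lookup_eq_zero\<close>)

lemma lcm_exp_empty [simp]: "lcm_exp {} = (\<lambda>_. 0)"
  by (simp add: lcm_exp_def)

lemma lcm_exp_Un:
  assumes "finite W" "finite V"
  shows "lcm_exp (W \<union> V) j = max (lcm_exp W j) (lcm_exp V j)"
proof -
  have "insert 0 ((\<lambda>a. a j) ` (W \<union> V)) = insert 0 ((\<lambda>a. a j) ` W) \<union> insert 0 ((\<lambda>a. a j) ` V)"
    by auto
  then show ?thesis
    using assms by (simp only: lcm_exp_def) (subst Max_Un, auto)
qed

lemma lcm_exp_singleton [simp]: "lcm_exp {m} = m"
  by (simp add: lcm_exp_def fun_eq_iff)

lemma lcm_exp_ge: "\<lbrakk>finite W; m \<in> W\<rbrakk> \<Longrightarrow> m j \<le> lcm_exp W j"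
  by (simp add: lcm_exp_def)

lemma lcm_exp_mono: "\<lbrakk>finite V; W \<subseteq> V\<rbrakk> \<Longrightarrow> lcm_exp W j \<le> lcm_exp V j"
  unfolding lcm_exp_def by (intro Max_mono) auto

text \<open>The sign exponent \<open>\<sigma>(W, V)\<close>: for disjoint sets, the number of adjacent transpositions that sort
  an increasing list of \<open>W\<close> followed by one of \<open>V\<close>.\<close>

definition inversions :: "('a \<times> 'a) set \<Rightarrow> 'a set \<Rightarrow> 'a set \<Rightarrow> nat" where
  "inversions r W V = card {(m, m'). m \<in> W \<and> m' \<in> V \<and> (m', m) \<in> r}"

lemma finite_inversion_set:
  assumes "finite W" "finite V"
  shows "finite {(m, m'). m \<in> W \<and> m' \<in> V \<and> (m', m) \<in> r}"
  by (rule finite_subset[of _ "W \<times> V"]) (use assms in auto)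

lemma inversions_empty [simp]: "inversions r {} V = 0" "inversions r W {} = 0"
  by (simp_all add: inversions_def)

lemma inversions_Un_left:
  assumes "finite W" "finite V" "finite U" "W \<inter> V = {}"
  shows "inversions r (W \<union> V) U = inversions r W U + inversions r V U"
proof -
  have "{(m, m'). m \<in> W \<union> V \<and> m' \<in> U \<and> (m', m) \<in> r} =
    {(m, m'). m \<in> W \<and> m' \<in> U \<and> (m', m) \<in> r} \<union> {(m, m'). m \<in> V \<and> m' \<in> U \<and> (m', m) \<in> r}"
    by auto
  then show ?thesis
    unfolding inversions_def
    using assms by (simp only:) (subst card_Un_disjoint, auto intro: finite_inversion_set)
qed

lemma inversions_Un_right:
  assumes "finite W" "finite V" "finite U" "V \<inter> U = {}"
  shows "inversions r W (V \<union> U) = inversions r W V + inversions r W U"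
proof -
  have "{(m, m'). m \<in> W \<and> m' \<in> V \<union> U \<and> (m', m) \<in> r} =
    {(m, m'). m \<in> W \<and> m' \<in> V \<and> (m', m) \<in> r} \<union> {(m, m'). m \<in> W \<and> m' \<in> U \<and> (m', m) \<in> r}"
    by auto
  then show ?thesis
    unfolding inversions_def
    using assms by (simp only:) (subst card_Un_disjoint, auto intro: finite_inversion_set)
qed

lemma taylor_basis_mult_disjoint:
  "W \<inter> V = {} \<Longrightarrow> taylor_basis_mult r W V =
    (-1) ^ inversions r W V * xpow (lcm_exp W + lcm_exp V - lcm_exp (W \<union> V))"
  by (simp add: taylor_basis_mult_def inversions_def)

lemma taylor_basis_mult_eq_0: "W \<inter> V \<noteq> {} \<Longrightarrow> taylor_basis_mult r W V = 0"
  by (simp add: taylor_basis_mult_def)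

lemma taylor_basis_mult_empty [simp]:
  "taylor_basis_mult r {} V = 1" "taylor_basis_mult r W {} = 1"
proof -
  have "(\<lambda>_. 0) + e - e = (\<lambda>_. 0)" "e + (\<lambda>_. 0) - e = (\<lambda>_. 0)" for e :: "'a \<Rightarrow> nat"
    by (simp_all add: fun_eq_iff)
  then show "taylor_basis_mult r {} V = 1" "taylor_basis_mult r W {} = 1"
    by (simp_all add: taylor_basis_mult_disjoint)
qed

text \<open>If \<open>W\<close>, \<open>V\<close> and \<open>U\<close> are pairwise disjoint, then both sides carry the sign exponent \<open>\<sigma>(W, V) + \<sigma>(W, U) + \<sigma>(V, U)\<close> and the monomial
  \<open>m\<^sub>W m\<^sub>V m\<^sub>U / m\<^sub>W\<^sub>\<union>\<^sub>V\<^sub>\<union>\<^sub>U\<close>; otherwise both vanish.\<close>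

lemma taylor_basis_mult_assoc:
  assumes "finite W" "finite V" "finite U"
  shows "taylor_basis_mult r W V * taylor_basis_mult r (W \<union> V) U =
    taylor_basis_mult r V U * (taylor_basis_mult r W (V \<union> U) :: ('n, 'k::field) mpoly)"
proof (cases "W \<inter> V = {} \<and> W \<inter> U = {} \<and> V \<inter> U = {}")
  case True
  let ?l = "lcm_exp :: ('n \<Rightarrow> nat) set \<Rightarrow> 'n \<Rightarrow> nat"
  have d: "W \<inter> V = {}" "V \<inter> U = {}" "(W \<union> V) \<inter> U = {}" "W \<inter> (V \<union> U) = {}"
    using True by auto
  have "(?l W + ?l V - ?l (W \<union> V)) + (?l (W \<union> V) + ?l U - ?l (W \<union> V \<union> U)) =
    (?l V + ?l U - ?l (V \<union> U)) + (?l W + ?l (V \<union> U) - ?l (W \<union> (V \<union> U)))"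
    using assms by (simp add: fun_eq_iff lcm_exp_Un max_def)
  then have x: "xpow (?l W + ?l V - ?l (W \<union> V)) * xpow (?l (W \<union> V) + ?l U - ?l (W \<union> V \<union> U)) =
    xpow (?l V + ?l U - ?l (V \<union> U)) * (xpow (?l W + ?l (V \<union> U) - ?l (W \<union> (V \<union> U))) :: ('n, 'k) mpoly)"
    by (simp only: xpow_add[symmetric])
  have "inversions r W V + inversions r (W \<union> V) U = inversions r V U + inversions r W (V \<union> U)"
    using True assms by (simp add: inversions_Un_left inversions_Un_right)
  then have s: "(-1) ^ inversions r W V * (-1) ^ inversions r (W \<union> V) U =
    (-1) ^ inversions r V U * ((-1) ^ inversions r W (V \<union> U) :: ('n, 'k) mpoly)"
    by (simp only: power_add[symmetric])
  have rearrange: "(a * b) * (c * d) = (a * c) * (b * d)" for a b c d :: "('n, 'k) mpoly"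
    by (simp add: ac_simps)
  show ?thesis
    unfolding taylor_basis_mult_disjoint[OF d(1)] taylor_basis_mult_disjoint[OF d(2)]
      taylor_basis_mult_disjoint[OF d(3)] taylor_basis_mult_disjoint[OF d(4)] rearrange x s ..
next
  case False
  then have "W \<inter> V \<noteq> {} \<or> (W \<union> V) \<inter> U \<noteq> {}" "V \<inter> U \<noteq> {} \<or> W \<inter> (V \<union> U) \<noteq> {}"
    by blast+
  then have "taylor_basis_mult r W V * taylor_basis_mult r (W \<union> V) U = (0 :: ('n, 'k) mpoly)"
    "taylor_basis_mult r V U * taylor_basis_mult r W (V \<union> U) = (0 :: ('n, 'k) mpoly)"
    using taylor_basis_mult_eq_0[of _ _ r] by (metis mult_zero_left mult_zero_right)+
  then show ?thesis by simp
qed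

locale taylor_algebra = squarefree_ideal I
  for I :: "('n::finite, 'k::field) mpoly set" +
  fixes r :: "(('n \<Rightarrow> nat) \<times> ('n \<Rightarrow> nat)) set"
  assumes order: "strict_linear_order_on (min_gens I) r"
begin

abbreviation G :: "('n \<Rightarrow> nat) set" where
  "G \<equiv> min_gens I"

abbreviation T :: "('n, 'k, ('n \<Rightarrow> nat) set \<Rightarrow>\<^sub>0 ('n, 'k) mpoly) mdga" where
  "T \<equiv> taylor I r"

lemma taylor_fields [simp]:
  "carrier T = {t. Poly_Mapping.keys t \<subseteq> Pow G}"
  "monoid.mult T = taylor_mult r" "monoid.one T = Poly_Mapping.single {} 1"
  "ring.zero T = 0" "ring.add T = (+)" "module.smult T = (\<lambda>s. Poly_Mapping.map ((*) s))"
  "bdry T = taylor_bdry r"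
  by (simp_all add: taylor_def)

lemma finite_G [simp]: "finite G"
  by (rule finite_min_gens)

lemma finite_subset_G: "W \<subseteq> G \<Longrightarrow> finite W"
  using finite_min_gens by (rule rev_finite_subset)

lemma keys_subset_add:
  "\<lbrakk>Poly_Mapping.keys t \<subseteq> A; Poly_Mapping.keys t' \<subseteq> A\<rbrakk> \<Longrightarrow> Poly_Mapping.keys (t + t') \<subseteq> A"
  using keys_add[of t t'] by blast

lemma keys_subset_sum:
  "(\<And>i. i \<in> B \<Longrightarrow> Poly_Mapping.keys (f i) \<subseteq> A) \<Longrightarrow> Poly_Mapping.keys (sum f B) \<subseteq> A"
  by (induction B rule: infinite_finite_induct) (simp_all add: keys_subset_add)

lemma taylor_expansion:
  "Poly_Mapping.keys t \<subseteq> Pow G \<Longrightarrow>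
    (\<Sum>W\<in>Pow G. Poly_Mapping.single W (Poly_Mapping.lookup t W)) = t"
  by (rule poly_mapping_eq_sum_superset[symmetric]) auto

lemma taylor_mult_eq:
  assumes "Poly_Mapping.keys t \<subseteq> Pow G" "Poly_Mapping.keys t' \<subseteq> Pow G"
  shows "taylor_mult r t t' = (\<Sum>W\<in>Pow G. \<Sum>V\<in>Pow G. Poly_Mapping.single (W \<union> V)
    (Poly_Mapping.lookup t W * Poly_Mapping.lookup t' V * taylor_basis_mult r W V))"
proof -
  have "taylor_mult r t t' = (\<Sum>W\<in>Poly_Mapping.keys t. \<Sum>V\<in>Pow G. Poly_Mapping.single (W \<union> V)
    (Poly_Mapping.lookup t W * Poly_Mapping.lookup t' V * taylor_basis_mult r W V))"
    unfolding taylor_mult_def using assms(2)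
    by (intro sum.cong[OF refl], intro sum.mono_neutral_left)
      (auto simp: not_in_keys_iff_lookup_eq_zero)
  also have "\<dots> = (\<Sum>W\<in>Pow G. \<Sum>V\<in>Pow G. Poly_Mapping.single (W \<union> V)
    (Poly_Mapping.lookup t W * Poly_Mapping.lookup t' V * taylor_basis_mult r W V))"
    using assms(1)
    by (intro sum.mono_neutral_left) (auto simp: not_in_keys_iff_lookup_eq_zero)
  finally show ?thesis .
qed

lemma taylor_mult_single:
  "taylor_mult r (Poly_Mapping.single W a) (Poly_Mapping.single V b) =
    Poly_Mapping.single (W \<union> V) (a * b * taylor_basis_mult r W V)"
  by (cases "a = 0"; cases "b = 0") (simp_all add: taylor_mult_def)

lemma taylor_mult_closed:
  assumes "Poly_Mapping.keys t \<subseteq> Pow G" "Poly_Mapping.keys t' \<subseteq> Pow G"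
  shows "Poly_Mapping.keys (taylor_mult r t t') \<subseteq> Pow G"
  unfolding taylor_mult_eq[OF assms] by (intro keys_subset_sum) auto

lemma taylor_mult_add_left:
  assumes "Poly_Mapping.keys t \<subseteq> Pow G" "Poly_Mapping.keys s \<subseteq> Pow G" "Poly_Mapping.keys t' \<subseteq> Pow G"
  shows "taylor_mult r (t + s) t' = taylor_mult r t t' + taylor_mult r s t'"
  using assms keys_subset_add[OF assms(1,2)]
  by (simp add: taylor_mult_eq lookup_add distrib_right single_add sum.distrib)

lemma taylor_mult_add_right:
  assumes "Poly_Mapping.keys t \<subseteq> Pow G" "Poly_Mapping.keys s \<subseteq> Pow G" "Poly_Mapping.keys t' \<subseteq> Pow G"
  shows "taylor_mult r t' (t + s) = taylor_mult r t' t + taylor_mult r t' s"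
  using assms keys_subset_add[OF assms(1,2)]
  by (simp add: taylor_mult_eq lookup_add distrib_right distrib_left single_add sum.distrib)

lemma taylor_mult_zero [simp]: "taylor_mult r 0 t = 0" "taylor_mult r t 0 = 0"
  by (simp_all add: taylor_mult_def)

lemma taylor_linear_induct [consumes 1, case_names add zero single]:
  fixes t :: "('n \<Rightarrow> nat) set \<Rightarrow>\<^sub>0 ('n, 'k) mpoly"
  assumes "Poly_Mapping.keys t \<subseteq> Pow G"
    and "\<And>t t'. \<lbrakk>Poly_Mapping.keys t \<subseteq> Pow G; Poly_Mapping.keys t' \<subseteq> Pow G; P t; P t'\<rbrakk> \<Longrightarrow> P (t + t')"
    and "P 0" and "\<And>W s. W \<subseteq> G \<Longrightarrow> P (Poly_Mapping.single W s)"
  shows "P t"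
proof -
  have "P (\<Sum>W\<in>A. Poly_Mapping.single W (Poly_Mapping.lookup t W))" if "A \<subseteq> Pow G" for A
    using finite_subset[OF that, simplified] that
  proof (induction A)
    case (insert W A)
    then have "P (Poly_Mapping.single W (Poly_Mapping.lookup t W) +
      (\<Sum>W\<in>A. Poly_Mapping.single W (Poly_Mapping.lookup t W)))"
      by (intro assms(2,4) keys_subset_sum) auto
    with insert.hyps show ?case by simp
  qed (simp add: assms(3))
  from this[of "Pow G"] show ?thesis
    by (simp add: taylor_expansion[OF assms(1)])
qed

lemma taylor_mult_assoc:
  fixes t t' t'' :: "('n \<Rightarrow> nat) set \<Rightarrow>\<^sub>0 ('n, 'k) mpoly"
  assumes "Poly_Mapping.keys t \<subseteq> Pow G" "Poly_Mapping.keys t' \<subseteq> Pow G" "Poly_Mapping.keys t'' \<subseteq> Pow G"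
  shows "taylor_mult r (taylor_mult r t t') t'' = taylor_mult r t (taylor_mult r t' t'')"
  using assms(1)
proof (induction t rule: taylor_linear_induct)
  case (add t s)
  with assms show ?case by (simp add: taylor_mult_add_left taylor_mult_closed)
next
  case (single W a)
  from assms(2) show ?case
  proof (induction t' rule: taylor_linear_induct)
    case (add t s)
    with assms single show ?case
      by (simp add: taylor_mult_add_left taylor_mult_add_right taylor_mult_closed)
  next
    case (single V b)
    from assms(3) show ?case
    proof (induction t'' rule: taylor_linear_induct)
      case (add t s)
      with assms single \<open>W \<subseteq> G\<close> show ?case
        by (simp add: taylor_mult_add_right taylor_mult_closed)
    next
      case (single U c)
      have "finite W" "finite V" "finite U"
        using \<open>W \<subseteq> G\<close> \<open>V \<subseteq> G\<close> \<open>U \<subseteq> G\<close> by (auto intro: finite_subset_G)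
      note assoc = taylor_basis_mult_assoc[OF this, of r]
      have "a * b * taylor_basis_mult r W V * c * taylor_basis_mult r (W \<union> V) U =
        a * b * c * (taylor_basis_mult r W V * taylor_basis_mult r (W \<union> V) U)"
        by (simp only: ac_simps)
      also have "\<dots> = a * (b * c * taylor_basis_mult r V U) * taylor_basis_mult r W (V \<union> U)"
        unfolding assoc by (simp only: ac_simps)
      finally show ?case
        by (simp add: taylor_mult_single Un_assoc)
    qed simp
  qed simp
qed simp

lemma taylor_mult_one:
  fixes t :: "('n \<Rightarrow> nat) set \<Rightarrow>\<^sub>0 ('n, 'k) mpoly"
  assumes "Poly_Mapping.keys t \<subseteq> Pow G"
  shows "taylor_mult r (Poly_Mapping.single {} 1) t = t" "taylor_mult r t (Poly_Mapping.single {} 1) = t"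
  using assms
  by (induction t rule: taylor_linear_induct)
    (simp_all add: taylor_mult_add_right taylor_mult_add_left taylor_mult_single)

lemma ring_taylor: "ring T"
proof (rule ringI)
  show "abelian_group T"
    by (rule abelian_groupI) (auto simp: keys_subset_add ac_simps intro!: exI[of _ "- _"])
  show "Group.monoid T"
    by (rule monoidI) (auto simp: taylor_mult_closed taylor_mult_one taylor_mult_assoc)
qed (auto simp: taylor_mult_add_left taylor_mult_add_right)

sublocale T: ring T
  by (rule ring_taylor)

lemma taylor_finsum:
  "(\<And>a. a \<in> A \<Longrightarrow> f a \<in> carrier T) \<Longrightarrow> finsum T f A = sum f A"
proof (induction A rule: infinite_finite_induct)
  case (insert a A)
  then show ?case by (subst T.finsum_insert) (auto simp: Pi_iff)
qed simp_all

lemma bicomp_taylor: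
  "t \<in> bicomp T i u \<longleftrightarrow> Poly_Mapping.keys t \<subseteq> Pow G \<and>
    (\<forall>W\<in>Poly_Mapping.keys t. card W = i \<and>
      homogeneous_poly (u - mdeg (lcm_exp W)) (Poly_Mapping.lookup t W))"
  by (simp add: taylor_def)

lemma homogeneous_poly_add:
  "\<lbrakk>homogeneous_poly u p; homogeneous_poly u q\<rbrakk> \<Longrightarrow> homogeneous_poly u (p + q)"
  unfolding homogeneous_poly_def using keys_add[of p q] by blast

lemma homogeneous_poly_0 [simp]: "homogeneous_poly u 0"
  by (simp add: homogeneous_poly_def)

lemma bicomp_taylor_iff:
  "t \<in> bicomp T i u \<longleftrightarrow> (\<forall>W. Poly_Mapping.lookup t W \<noteq> 0 \<longrightarrow> W \<subseteq> G \<and> card W = i) \<and>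
    (\<forall>W. homogeneous_poly (u - mdeg (lcm_exp W)) (Poly_Mapping.lookup t W))"
  unfolding bicomp_taylor by (force simp: in_keys_iff homogeneous_poly_def[of _ 0])

lemma bicomp_taylor_zero [simp]: "0 \<in> bicomp T i u"
  by (simp add: bicomp_taylor_iff)

lemma bicomp_taylor_add:
  assumes "t \<in> bicomp T i u" "t' \<in> bicomp T i u" shows "t + t' \<in> bicomp T i u"
  using assms unfolding bicomp_taylor_iff lookup_add
  by (metis add.right_neutral homogeneous_poly_add)

lemma bicomp_taylor_sum:
  "(\<And>a. a \<in> A \<Longrightarrow> f a \<in> bicomp T i u) \<Longrightarrow> sum f A \<in> bicomp T i u"
  by (induction A rule: infinite_finite_induct) (simp_all add: bicomp_taylor_add)

lemma bicomp_taylor_single: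
  assumes "W \<subseteq> G" "u = mdeg (lcm_exp W) + mdeg a"
  shows "Poly_Mapping.single W (Poly_Mapping.single a c) \<in> bicomp T (card W) u"
proof -
  have "mdeg (lcm_exp W) + mdeg a - mdeg (lcm_exp W) = mdeg a" by (simp add: fun_eq_iff)
  then show ?thesis
    using assms by (auto simp: bicomp_taylor lookup_single homogeneous_single)
qed

text \<open>The terms \<open>c x\<^sup>a g\<^sub>W\<close> of an element are homogeneous, of bidegree \<open>(card W, lcm W + a)\<close>; \<open>f d\<close> collects
  those of bidegree \<open>d\<close>.\<close>

lemma taylor_homogeneous_parts:
  assumes "Poly_Mapping.keys t \<subseteq> Pow G"
  obtains D f where "finite D" "\<And>i u. f (i, u) \<in> bicomp T i u" "\<And>d. d \<notin> D \<Longrightarrow> f d = 0" "t = sum f D"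
proof -
  define Q where "Q = (SIGMA W:Poly_Mapping.keys t. Poly_Mapping.keys (Poly_Mapping.lookup t W))"
  define dg where "dg q = (card (fst q), mdeg (lcm_exp (fst q)) + mdeg (snd q))"
    for q :: "('n \<Rightarrow> nat) set \<times> ('n \<Rightarrow> nat)"
  define tm where "tm q = Poly_Mapping.single (fst q)
      (Poly_Mapping.single (snd q) (Poly_Mapping.lookup (Poly_Mapping.lookup t (fst q)) (snd q)))" for q
  define f where "f d = sum tm {q \<in> Q. dg q = d}" for d
  have Q: "finite Q" unfolding Q_def by (intro finite_SigmaI) auto
  have single_sum: "Poly_Mapping.single W (sum g A) = (\<Sum>a\<in>A. Poly_Mapping.single W (g a))"
    for W :: "('n \<Rightarrow> nat) set" and g :: "('n \<Rightarrow> nat) \<Rightarrow> ('n, 'k) mpoly" and A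
    by (induction A rule: infinite_finite_induct) (simp_all add: single_add)
  have "t = (\<Sum>W\<in>Poly_Mapping.keys t. \<Sum>a\<in>Poly_Mapping.keys (Poly_Mapping.lookup t W). tm (W, a))"
    unfolding tm_def fst_conv snd_conv single_sum[symmetric]
      poly_mapping_eq_sum_single[symmetric] ..
  also have "\<dots> = sum tm Q"
    unfolding Q_def by (subst sum.Sigma) (auto simp: case_prod_beta)
  also have "\<dots> = sum f (dg ` Q)"
    unfolding f_def using Q by (rule sum.image_gen)
  finally have "t = sum f (dg ` Q)" .
  moreover have "f (i, u) \<in> bicomp T i u" for i u
  proof -
    have "tm q \<in> bicomp T i u" if "q \<in> Q" "dg q = (i, u)" for q
      using bicomp_taylor_single[of "fst q" u "snd q"] that assms
      by (auto simp: tm_def dg_def Q_def)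
    then show ?thesis unfolding f_def by (intro bicomp_taylor_sum) auto
  qed
  moreover have "f d = 0" if "d \<notin> dg ` Q" for d
  proof -
    have none: "{q \<in> Q. dg q = d} = {}" using that by blast
    show ?thesis unfolding f_def none by simp
  qed
  ultimately show thesis using that Q by blast
qed

end

section \<open>Products of degree one elements\<close>

lemma exists_sorted_enumeration:
  assumes "finite A" "strict_linear_order_on A r"
  obtains xs where "set xs = A" "distinct xs" "sorted_wrt (\<lambda>a b. (a, b) \<in> r) xs"
proof -
  have r: "trans r" "irrefl r" "total_on A r"
    using assms(2) by (auto simp: strict_linear_order_on_def)
  have "\<exists>xs. set xs = B \<and> distinct xs \<and> sorted_wrt (\<lambda>a b. (a, b) \<in> r) xs"
    if "finite B" "B \<subseteq> A" for B
    using that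
  proof (induction B)
    case (insert b B)
    then obtain xs where xs: "set xs = B" "distinct xs" "sorted_wrt (\<lambda>a b. (a, b) \<in> r) xs"
      by auto
    let ?ys = "filter (\<lambda>a. (a, b) \<in> r) xs @ b # filter (\<lambda>a. (b, a) \<in> r) xs"
    have "set ?ys = insert b B"
      using xs(1) insert.prems insert.hyps r(3) by (fastforce simp: total_on_def)
    moreover have "distinct ?ys"
      using xs insert.hyps r(1,2) by (auto simp: irrefl_def dest: transD)
    moreover have "sorted_wrt (\<lambda>a b. (a, b) \<in> r) ?ys"
      using xs(3) r(1) by (auto simp: sorted_wrt_append sorted_wrt_filter dest: transD)
    ultimately show ?case by blast
  qed simp
  from this[OF assms(1)] that show thesis by blast
qed

definition exp_sum :: "('n \<Rightarrow> nat) set \<Rightarrow> ('n \<Rightarrow> nat)" where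
  "exp_sum W = (\<lambda>j. \<Sum>m\<in>W. m j)"

lemma exp_sum_empty [simp]: "exp_sum {} = (\<lambda>_. 0)"
  by (simp add: exp_sum_def)

lemma exp_sum_insert: "\<lbrakk>finite W; m \<notin> W\<rbrakk> \<Longrightarrow> exp_sum (insert m W) = m + exp_sum W"
  by (simp add: exp_sum_def fun_eq_iff)

lemma exp_sum_Un: "\<lbrakk>finite W; finite V; W \<inter> V = {}\<rbrakk> \<Longrightarrow> exp_sum (W \<union> V) = exp_sum W + exp_sum V"
  by (simp add: exp_sum_def fun_eq_iff sum.union_disjoint)

lemma lcm_exp_le_exp_sum:
  assumes "finite W" shows "lcm_exp W j \<le> exp_sum W j"
  using assms unfolding lcm_exp_def exp_sum_def by (auto intro: member_le_sum)

text \<open>The exponent of the monomial by which a product of elements with degrees in \<open>W\<close> is divided.\<close>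

definition excess :: "('n \<Rightarrow> nat) set \<Rightarrow> ('n \<Rightarrow> nat)" where
  "excess W = exp_sum W - lcm_exp W"

lemma excess: "finite W \<Longrightarrow> exp_sum W j = lcm_exp W j + excess W j"
  by (simp add: excess_def lcm_exp_le_exp_sum)

locale squarefree_dga_resolution =
  squarefree_resolution I F + multigraded_dga F + taylor_algebra I r
  for I :: "('n::finite, 'k::field) mpoly set"
    and F :: "('n, 'k, 'f) mdga" (structure)
    and r :: "(('n \<Rightarrow> nat) \<times> ('n \<Rightarrow> nat)) set"
begin

lemma ring_F: "ring F"
  by (rule ring_axioms)

lemma mult_carrier [simp, intro]: "\<lbrakk>x \<in> carrier F; y \<in> carrier F\<rbrakk> \<Longrightarrow> x \<otimes> y \<in> carrier F"
  by (rule ring.ring_simprules(5)[OF ring_F])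

lemma mult_assoc:
  "\<lbrakk>x \<in> carrier F; y \<in> carrier F; z \<in> carrier F\<rbrakk> \<Longrightarrow> (x \<otimes> y) \<otimes> z = x \<otimes> (y \<otimes> z)"
  by (rule monoid.m_assoc[OF ring.is_monoid[OF ring_F]])

lemma mult_one [simp]: "x \<in> carrier F \<Longrightarrow> x \<otimes> \<one> = x" "x \<in> carrier F \<Longrightarrow> \<one> \<otimes> x = x"
  by (simp_all add: monoid.l_one[OF ring.is_monoid[OF ring_F]] monoid.r_one[OF ring.is_monoid[OF ring_F]])

lemma mult_zero [simp]: "x \<in> carrier F \<Longrightarrow> x \<otimes> \<zero> = \<zero>" "x \<in> carrier F \<Longrightarrow> \<zero> \<otimes> x = \<zero>"
  by simp_all

lemma mult_add:
  "\<lbrakk>x \<in> carrier F; y \<in> carrier F; z \<in> carrier F\<rbrakk> \<Longrightarrow> x \<otimes> (y \<oplus> z) = x \<otimes> y \<oplus> x \<otimes> z"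
  "\<lbrakk>x \<in> carrier F; y \<in> carrier F; z \<in> carrier F\<rbrakk> \<Longrightarrow> (y \<oplus> z) \<otimes> x = y \<otimes> x \<oplus> z \<otimes> x"
  using ring_F unfolding ring_def ring_axioms_def by blast+

lemma mult_finsum:
  assumes "x \<in> carrier F" "f \<in> A \<rightarrow> carrier F"
  shows "x \<otimes> finsum F f A = finsum F (\<lambda>a. x \<otimes> f a) A"
  by (rule hom_finsum) (use assms in \<open>simp_all add: mult_add\<close>)

definition gen :: "('n \<Rightarrow> nat) \<Rightarrow> 'f" where
  "gen m = (SOME z. z \<in> bicomp F 1 (mdeg m) \<and> \<partial> z = xpow m \<odot> \<one>)"

lemma gen:
  assumes "m \<in> G"
  shows "gen m \<in> bicomp F 1 (mdeg m)" "\<partial> (gen m) = xpow m \<odot> \<one>"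
proof -
  have "xpow m \<odot> \<one> \<in> bicomp F 0 (mdeg m)"
    unfolding xpow_def by (rule single_one_bicomp)
  moreover have "xpow m \<in> I"
    using assms by (simp add: min_gens_def)
  ultimately have "\<exists>z. z \<in> bicomp F 1 (mdeg m) \<and> \<partial> z = xpow m \<odot> \<one>"
    using ideal_lift by metis
  from someI_ex[OF this, folded gen_def]
  show "gen m \<in> bicomp F 1 (mdeg m)" "\<partial> (gen m) = xpow m \<odot> \<one>" by auto
qed

lemma gen_carrier [simp]: "m \<in> G \<Longrightarrow> gen m \<in> carrier F"
  using gen(1) by blast

text \<open>Graded commutativity gives only \<open>2 g\<^sup>2 = 0\<close> for \<open>g\<close> of degree one. In characteristic two
  it is the minimality of the resolution that makes squares vanish: \<open>g\<^sup>2\<close> is divisible by \<open>x\<^sup>m\<close>,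
  with a quotient in \<open>F\<^sub>2\<close> of multidegree \<open>m\<close>, and there is none but zero.\<close>

lemma gen_square:
  assumes "m \<in> G" shows "gen m \<otimes> gen m = \<zero>"
proof -
  have "gen m \<otimes> gen m \<in> bicomp F (1 + 1) (mdeg m + mdeg m)"
    by (intro mult_bicomp gen assms)
  then obtain y where "y \<in> bicomp F (1 + 1) (mdeg m)" "gen m \<otimes> gen m = xpow m \<odot> y"
    by (rule divisible_by_xpow) simp
  with bicomp_2_min_gen[OF assms, of y] show ?thesis by (simp add: numeral_2_eq_2)
qed

text \<open>The product of the \<open>gen m\<close> with \<open>m \<in> W\<close> in the order of a list \<open>xs\<close>. Keeping \<open>xs\<close> and \<open>W\<close> apart makes
  induction over the list possible while \<open>W\<close> stays fixed.\<close>

primrec gen_prod :: "('n \<Rightarrow> nat) list \<Rightarrow> ('n \<Rightarrow> nat) set \<Rightarrow> 'f" where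
  "gen_prod [] W = \<one>"
| "gen_prod (m # xs) W = (if m \<in> W then gen m \<otimes> gen_prod xs W else gen_prod xs W)"

lemma gen_prod_cong: "W \<inter> set xs = V \<inter> set xs \<Longrightarrow> gen_prod xs W = gen_prod xs V"
proof (induction xs)
  case (Cons m xs)
  then have "W \<inter> set xs = V \<inter> set xs" "m \<in> W \<longleftrightarrow> m \<in> V" by auto
  with Cons.IH show ?case by simp
qed simp

abbreviation sorted_gens :: "('n \<Rightarrow> nat) list \<Rightarrow> bool" where
  "sorted_gens xs \<equiv> set xs \<subseteq> G \<and> distinct xs \<and> sorted_wrt (\<lambda>a b. (a, b) \<in> r) xs"

lemma order_asym: "(a, b) \<in> r \<Longrightarrow> (b, a) \<notin> r"
  using order by (auto simp: strict_linear_order_on_def irrefl_def dest: transD)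

lemma gen_prod_bicomp:
  assumes "sorted_gens xs"
  shows "gen_prod xs W \<in> bicomp F (card (W \<inter> set xs)) (mdeg (exp_sum (W \<inter> set xs)))"
  using assms
proof (induction xs)
  case Nil
  show ?case using one_bicomp by (simp add: zero_fun_def)
next
  case (Cons m xs)
  show ?case
  proof (cases "m \<in> W")
    case True
    have m: "m \<notin> W \<inter> set xs" "m \<in> G" using Cons.prems by auto
    have eq: "W \<inter> set (m # xs) = insert m (W \<inter> set xs)" using True by auto
    have "mdeg m + mdeg (exp_sum (W \<inter> set xs)) = mdeg (exp_sum (insert m (W \<inter> set xs)))"
      using m by (simp add: exp_sum_insert fun_eq_iff)
    moreover have "1 + card (W \<inter> set xs) = card (insert m (W \<inter> set xs))"
      using m by simp
    ultimately show ?thesis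
      using mult_bicomp[OF gen(1)[OF m(2)] Cons.IH] Cons.prems True unfolding eq by simp
  next
    case False
    then have "W \<inter> set (m # xs) = W \<inter> set xs" by auto
    with False Cons show ?thesis by simp
  qed
qed

lemma gen_prod_carrier [simp]: "set xs \<subseteq> G \<Longrightarrow> gen_prod xs W \<in> carrier F"
  by (induction xs) auto

text \<open>The iterated Leibniz rule. The head \<open>a\<close> of a sorted list precedes everything in the tail: the
  term for \<open>a\<close> has no sign, and moving \<open>\<partial>\<close> past \<open>gen a\<close> gives each of the other terms one more sign,
  as \<open>a\<close> does in the count of predecessors.\<close>

lemma gen_prod_bdry:
  assumes "sorted_gens xs"
  shows "\<partial> (gen_prod xs W) = finsum F (\<lambda>m. ((-1) ^ card {m' \<in> W \<inter> set xs. (m', m) \<in> r} * xpow m) \<odot>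
    gen_prod xs (W - {m})) (W \<inter> set xs)"
  using assms
proof (induction xs)
  case Nil
  show ?case using bdry_bicomp_0[OF one_bicomp] by simp
next
  case (Cons a xs)
  then have a: "a \<in> G" "a \<notin> set xs" "\<And>m. m \<in> set xs \<Longrightarrow> (a, m) \<in> r" and xs: "sorted_gens xs"
    by auto
  let ?c = "\<lambda>xs m. card {m' \<in> W \<inter> set xs. (m', m) \<in> r}"
  let ?t = "\<lambda>xs m. ((-1) ^ ?c xs m * xpow m) \<odot> gen_prod xs (W - {m})"
  have closed: "gen_prod ys V \<in> carrier F" if "set ys \<subseteq> set (a # xs)" for ys V
    using that Cons.prems by (intro gen_prod_carrier) auto
  have closed_xs [simp]: "gen_prod xs V \<in> carrier F" for V
    by (rule closed) auto
  show ?case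
  proof (cases "a \<in> W")
    case False
    then have eq: "W \<inter> set (a # xs) = W \<inter> set xs" by auto
    show ?thesis
      using Cons.IH[OF xs] False unfolding eq by simp
  next
    case True
    have eq: "W \<inter> set (a # xs) = insert a (W \<inter> set xs)" using True by auto
    have c_a: "{m' \<in> insert a (W \<inter> set xs). (m', a) \<in> r} = {}"
      using a order_asym by blast
    have c_m: "{m' \<in> insert a (W \<inter> set xs). (m', m) \<in> r} = insert a {m' \<in> W \<inter> set xs. (m', m) \<in> r}"
      if "m \<in> set xs" for m
      using a(3)[OF that] by blast
    have t_a: "?t (a # xs) a = xpow a \<odot> gen_prod xs W"
    proof -
      have "gen_prod xs (W - {a}) = gen_prod xs W"
        using a(2) by (intro gen_prod_cong) auto
      then show ?thesis unfolding eq c_a by simp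
    qed
    have t_m: "?t (a # xs) m = (-1) \<odot> (gen a \<otimes> ?t xs m)" if m: "m \<in> W \<inter> set xs" for m
    proof -
      have "card (insert a {m' \<in> W \<inter> set xs. (m', m) \<in> r}) = Suc (?c xs m)"
        using a(2) by (subst card_insert_disjoint) auto
      moreover have "m \<noteq> a" using a(2) m by blast
      moreover have "gen_prod xs (W - {m}) \<in> carrier F" by (rule closed) auto
      ultimately show ?thesis
        using True a(1) c_m[of m] m unfolding eq by (simp add: smult_mult_right)
    qed
    have "\<partial> (gen_prod (a # xs) W) = \<partial> (gen a \<otimes> gen_prod xs W)"
      using True by simp
    also have "\<dots> = (xpow a \<odot> \<one>) \<otimes> gen_prod xs W \<oplus> (-1) ^ 1 \<odot> (gen a \<otimes> \<partial> (gen_prod xs W))"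
      using leibniz[OF gen(1)[OF a(1)] gen_prod_bicomp[OF xs]] gen(2)[OF a(1)] by simp
    also have "(xpow a \<odot> \<one>) \<otimes> gen_prod xs W = ?t (a # xs) a"
      unfolding t_a by (simp add: smult_mult_left)
    also have "(-1) ^ 1 \<odot> (gen a \<otimes> \<partial> (gen_prod xs W)) =
        finsum F (\<lambda>m. (-1) \<odot> (gen a \<otimes> ?t xs m)) (W \<inter> set xs)"
    proof -
      have "gen a \<otimes> \<partial> (gen_prod xs W) = finsum F (\<lambda>m. gen a \<otimes> ?t xs m) (W \<inter> set xs)"
        unfolding Cons.IH[OF xs] using a(1) by (intro mult_finsum) auto
      then show ?thesis using a(1) by (simp only: power_one_right) (intro smult_finsum, auto)
    qed
    also have "\<dots> = finsum F (?t (a # xs)) (W \<inter> set xs)"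
      using a(1) by (intro M.finsum_cong' t_m[symmetric]) (auto simp del: gen_prod.simps intro!: closed smult_carrier)
    also have "?t (a # xs) a \<oplus> \<dots> = finsum F (?t (a # xs)) (insert a (W \<inter> set xs))"
      using a closed[of "a # xs"] by (intro M.finsum_insert[symmetric]) (auto simp del: gen_prod.simps)
    finally show ?thesis unfolding eq .
  qed
qed

text \<open>Again by splitting off the least element \<open>a\<close>. If \<open>a\<close> occurs in the second factor only, it has to
  pass all elements of the first, with each of which it forms an inversion. If it occurs in both, a
  square appears.\<close>

lemma gen_prod_mult:
  assumes "sorted_gens xs"
  shows "gen_prod xs W \<otimes> gen_prod xs V =
    (if W \<inter> V \<inter> set xs = {} then (-1) ^ inversions r (W \<inter> set xs) (V \<inter> set xs) \<odot> gen_prod xs (W \<union> V)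
     else \<zero>)"
  using assms
proof (induction xs)
  case (Cons a xs)
  then have a: "a \<in> G" "a \<notin> set xs" "\<And>m. m \<in> set xs \<Longrightarrow> (a, m) \<in> r" and xs: "sorted_gens xs"
    by auto
  define k where "k = card (W \<inter> set xs)"
  have [simp]: "gen_prod xs U \<in> carrier F" for U
    using xs by (intro gen_prod_carrier) auto
  have [simp]: "gen a \<in> carrier F" using a(1) by simp
  have IH: "gen_prod xs W \<otimes> gen_prod xs V = (if W \<inter> V \<inter> set xs = {}
    then (-1) ^ inversions r (W \<inter> set xs) (V \<inter> set xs) \<odot> gen_prod xs (W \<union> V) else \<zero>)"
    by (rule Cons.IH[OF xs])
  have swap: "gen_prod xs W \<otimes> (gen a \<otimes> gen_prod xs V) =
    (-1) ^ k \<odot> (gen a \<otimes> (gen_prod xs W \<otimes> gen_prod xs V))"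
  proof -
    have "gen_prod xs W \<otimes> gen a = (-1) ^ k \<odot> (gen a \<otimes> gen_prod xs W)"
      using graded_comm[OF gen_prod_bicomp[OF xs, of W] gen(1)[OF a(1)]] by (simp add: k_def)
    then have "(gen_prod xs W \<otimes> gen a) \<otimes> gen_prod xs V =
      (-1) ^ k \<odot> ((gen a \<otimes> gen_prod xs W) \<otimes> gen_prod xs V)"
      by (simp add: smult_mult_left)
    then show ?thesis by (simp add: mult_assoc)
  qed
  have none: "inversions r {a} (V \<inter> set xs) = 0"
  proof -
    have "{(m, m'). m \<in> {a} \<and> m' \<in> V \<inter> set xs \<and> (m', m) \<in> r} = {}"
      using a(3) order_asym by blast
    then show ?thesis unfolding inversions_def by (simp only: card.empty)
  qed
  have all: "inversions r (W \<inter> set xs) {a} = k"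
  proof -
    have "{(m, m'). m \<in> W \<inter> set xs \<and> m' \<in> {a} \<and> (m', m) \<in> r} = (\<lambda>m. (m, a)) ` (W \<inter> set xs)"
      using a(3) by auto
    then show ?thesis
      unfolding inversions_def k_def by (simp add: card_image inj_on_def)
  qed
  consider "a \<in> W" "a \<in> V" | "a \<in> W" "a \<notin> V" | "a \<notin> W" "a \<in> V" | "a \<notin> W" "a \<notin> V" by blast
  then show ?case
  proof cases
    case 1
    have "gen a \<otimes> (gen a \<otimes> x) = \<zero>" if "x \<in> carrier F" for x
      using that gen_square[OF a(1)] by (simp add: mult_assoc[symmetric])
    then have "gen_prod (a # xs) W \<otimes> gen_prod (a # xs) V = \<zero>"
      using 1 by (simp add: mult_assoc swap smult_mult_right)
    with 1 show ?thesis by auto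
  next
    case 2
    have eq: "W \<inter> set (a # xs) = {a} \<union> (W \<inter> set xs)" "V \<inter> set (a # xs) = V \<inter> set xs"
      "W \<inter> V \<inter> set (a # xs) = W \<inter> V \<inter> set xs"
      using 2 by auto
    have inv: "inversions r ({a} \<union> (W \<inter> set xs)) (V \<inter> set xs) = inversions r (W \<inter> set xs) (V \<inter> set xs)"
      using none a(2) by (subst inversions_Un_left) auto
    have "gen_prod (a # xs) W \<otimes> gen_prod (a # xs) V = gen a \<otimes> (gen_prod xs W \<otimes> gen_prod xs V)"
      using 2 by (simp add: mult_assoc)
    then show ?thesis
      unfolding eq inv IH using 2 by (simp add: smult_mult_right)
  next
    case 3
    have eq: "V \<inter> set (a # xs) = {a} \<union> (V \<inter> set xs)" "W \<inter> set (a # xs) = W \<inter> set xs"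
      "W \<inter> V \<inter> set (a # xs) = W \<inter> V \<inter> set xs"
      using 3 by auto
    have inv: "inversions r (W \<inter> set xs) ({a} \<union> (V \<inter> set xs)) = k + inversions r (W \<inter> set xs) (V \<inter> set xs)"
      using all a(2) by (subst inversions_Un_right) auto
    have "gen_prod (a # xs) W \<otimes> gen_prod (a # xs) V =
        (-1) ^ k \<odot> (gen a \<otimes> (gen_prod xs W \<otimes> gen_prod xs V))"
      using 3 by (simp add: swap)
    then show ?thesis
      unfolding eq inv IH using 3 by (simp add: smult_mult_right power_add)
  next
    case 4
    then have eq: "W \<inter> set (a # xs) = W \<inter> set xs" "V \<inter> set (a # xs) = V \<inter> set xs"
      "W \<inter> V \<inter> set (a # xs) = W \<inter> V \<inter> set xs"
      by auto
    from 4 show ?thesis unfolding eq using IH by simp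
  qed
qed simp


section \<open>The comparison map\<close>

definition enum_gens :: "('n \<Rightarrow> nat) list" where
  "enum_gens = (SOME xs. set xs = G \<and> distinct xs \<and> sorted_wrt (\<lambda>a b. (a, b) \<in> r) xs)"

lemma enum_gens: "set enum_gens = G" "sorted_gens enum_gens"
proof -
  have "\<exists>xs. set xs = G \<and> distinct xs \<and> sorted_wrt (\<lambda>a b. (a, b) \<in> r) xs"
    using exists_sorted_enumeration[OF finite_G order] by metis
  from someI_ex[OF this, folded enum_gens_def]
  show "set enum_gens = G" "sorted_gens enum_gens" by auto
qed

abbreviation prod_of :: "('n \<Rightarrow> nat) set \<Rightarrow> 'f" where
  "prod_of W \<equiv> gen_prod enum_gens W"

text \<open>The product of the lifts of the elements of \<open>W\<close> has multidegree \<open>exp_sum W\<close>; divided by a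
  monomial it becomes an element \<open>img W\<close> of multidegree \<open>lcm_exp W\<close>, the image of the Taylor basis
  element \<open>g\<^sub>W\<close>.\<close>

definition img :: "('n \<Rightarrow> nat) set \<Rightarrow> 'f" where
  "img W = (SOME y. y \<in> bicomp F (card W) (mdeg (lcm_exp W)) \<and> prod_of W = xpow (excess W) \<odot> y)"

lemma img:
  assumes "W \<subseteq> G"
  shows "img W \<in> bicomp F (card W) (mdeg (lcm_exp W))" "prod_of W = xpow (excess W) \<odot> img W"
proof -
  have W: "finite W" "W \<inter> set enum_gens = W"
    using assms enum_gens(1) by (auto intro: finite_subset_G)
  have "mdeg (exp_sum W) = mdeg (lcm_exp W) + mdeg (excess W)"
    by (simp add: fun_eq_iff excess[OF W(1)])
  then have "prod_of W \<in> bicomp F (card W) (mdeg (lcm_exp W) + mdeg (excess W))"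
    using gen_prod_bicomp[OF enum_gens(2), of W] W(2) by simp
  moreover have "1 \<le> mdeg (lcm_exp W) j" if "0 < excess W j" for j
  proof -
    have "0 < exp_sum W j"
      using that excess[OF W(1), of j] by simp
    then obtain m where "m \<in> W" "0 < m j"
      using W(1) by (auto simp: exp_sum_def sum_eq_0_iff simp flip: neq0_conv)
    with lcm_exp_ge[OF W(1), of m j] show ?thesis by simp
  qed
  ultimately obtain y where "y \<in> bicomp F (card W) (mdeg (lcm_exp W))" "prod_of W = xpow (excess W) \<odot> y"
    by (rule divisible_by_xpow)
  then have "\<exists>y. y \<in> bicomp F (card W) (mdeg (lcm_exp W)) \<and> prod_of W = xpow (excess W) \<odot> y"
    by blast
  from someI_ex[OF this, folded img_def]
  show "img W \<in> bicomp F (card W) (mdeg (lcm_exp W))" "prod_of W = xpow (excess W) \<odot> img W" by auto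
qed

lemma img_carrier [simp]: "W \<subseteq> G \<Longrightarrow> img W \<in> carrier F"
  using img(1) by blast

lemma prod_of_carrier [simp]: "prod_of W \<in> carrier F"
  using enum_gens by (intro gen_prod_carrier) simp

lemma img_empty: "img {} = \<one>"
proof -
  have "gen_prod xs {} = \<one>" for xs by (induction xs) simp_all
  moreover have "xpow (excess {}) = (1 :: ('n, 'k) mpoly)"
    by (simp add: excess_def zero_fun_def xpow_def)
  ultimately show ?thesis using img(2)[of "{}"] by simp
qed

text \<open>Since \<open>F\<close> is torsion-free, the relations between the \<open>img W\<close> follow from those between the
  undivided products after multiplication by a monomial.\<close>

lemma img_mult:
  assumes W: "W \<subseteq> G" and V: "V \<subseteq> G"
  shows "img W \<otimes> img V = taylor_basis_mult r W V \<odot> img (W \<union> V)"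
proof (rule xpow_smult_cancel)
  let ?e = "excess W + excess V"
  have fin: "finite W" "finite V" using W V by (auto intro: finite_subset_G)
  have WV: "W \<inter> set enum_gens = W" "V \<inter> set enum_gens = V" "W \<inter> V \<inter> set enum_gens = W \<inter> V"
    using W V enum_gens(1) by auto
  have "xpow ?e \<odot> (img W \<otimes> img V) = prod_of W \<otimes> prod_of V"
    using W V by (simp add: img(2) smult_mult_left smult_mult_right xpow_add mult.commute)
  also have "\<dots> = xpow ?e \<odot> (taylor_basis_mult r W V \<odot> img (W \<union> V))"
  proof (cases "W \<inter> V = {}")
    case False
    with gen_prod_mult[OF enum_gens(2), of W V] W V show ?thesis
      unfolding WV by (simp add: taylor_basis_mult_eq_0)
  next
    case True
    have "?e + (lcm_exp W + lcm_exp V - lcm_exp (W \<union> V)) = excess (W \<union> V)"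
    proof
      fix j
      have "exp_sum (W \<union> V) j = exp_sum W j + exp_sum V j"
        using fin True by (simp add: exp_sum_Un)
      with fin excess[of W j] excess[of V j] excess[of "W \<union> V" j]
      show "(?e + (lcm_exp W + lcm_exp V - lcm_exp (W \<union> V))) j = excess (W \<union> V) j"
        by (simp add: lcm_exp_Un max_def)
    qed
    then have x: "xpow (excess (W \<union> V)) =
        xpow ?e * (xpow (lcm_exp W + lcm_exp V - lcm_exp (W \<union> V)) :: ('n, 'k) mpoly)"
      by (simp only: xpow_add[symmetric])
    have "prod_of W \<otimes> prod_of V = (-1) ^ inversions r W V \<odot> prod_of (W \<union> V)"
      using gen_prod_mult[OF enum_gens(2), of W V] True unfolding WV by simp
    also have "\<dots> = xpow ?e \<odot> (taylor_basis_mult r W V \<odot> img (W \<union> V))"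
      using W V True by (simp add: img(2) x taylor_basis_mult_disjoint mult.assoc mult.commute mult.left_commute)
    finally show ?thesis .
  qed
  finally show "xpow ?e \<odot> (img W \<otimes> img V) = xpow ?e \<odot> (taylor_basis_mult r W V \<odot> img (W \<union> V))" .
qed (use assms in simp_all)

lemma img_singleton:
  assumes "m \<in> G" shows "img {m} = gen m"
proof -
  have "gen_prod xs {m} = (if m \<in> set xs then gen m else \<one>)" if "distinct xs" for xs
    using that
  proof (induction xs)
    case (Cons a xs)
    have "gen_prod xs {m} = \<one>" if "m \<notin> set xs"
      using Cons that by simp
    with Cons assms show ?case by auto
  qed simp
  then have "prod_of {m} = gen m" using assms enum_gens by simp
  moreover have "xpow (excess {m}) = (1 :: ('n, 'k) mpoly)"
    by (simp add: excess_def exp_sum_def xpow_def)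
  ultimately show ?thesis using img(2)[of "{m}"] assms by simp
qed

lemma img_bdry:
  assumes W: "W \<subseteq> G"
  shows "\<partial> (img W) = finsum F (\<lambda>m. ((-1) ^ card {m' \<in> W. (m', m) \<in> r} *
    xpow (lcm_exp W - lcm_exp (W - {m}))) \<odot> img (W - {m})) W"
proof (rule xpow_smult_cancel)
  let ?s = "\<lambda>m. (-1) ^ card {m' \<in> W. (m', m) \<in> r} :: ('n, 'k) mpoly"
  let ?t = "\<lambda>m. (?s m * xpow (lcm_exp W - lcm_exp (W - {m}))) \<odot> img (W - {m})"
  have fin: "finite W" using W by (rule finite_subset_G)
  have sub: "W - {m} \<subseteq> G" for m using W by blast
  have "xpow (excess W) \<odot> \<partial> (img W) = \<partial> (prod_of W)"
    using img(2)[OF W] bdry_smult W by simp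
  also have "\<dots> = finsum F (\<lambda>m. (?s m * xpow m) \<odot> prod_of (W - {m})) W"
  proof -
    have "W \<inter> set enum_gens = W" using W enum_gens(1) by auto
    then show ?thesis using gen_prod_bdry[OF enum_gens(2), of W] by simp
  qed
  also have "\<dots> = finsum F (\<lambda>m. xpow (excess W) \<odot> ?t m) W"
  proof (rule M.finsum_cong')
    fix m assume m: "m \<in> W"
    have "m + excess (W - {m}) = excess W + (lcm_exp W - lcm_exp (W - {m}))"
    proof
      fix j
      have "exp_sum W = m + exp_sum (W - {m})"
        using exp_sum_insert[of "W - {m}" m] fin m by (simp add: insert_absorb)
      then have "exp_sum W j = m j + exp_sum (W - {m}) j" by simp
      moreover have "lcm_exp (W - {m}) j \<le> lcm_exp W j"
        using fin by (intro lcm_exp_mono) auto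
      ultimately show "(m + excess (W - {m})) j = (excess W + (lcm_exp W - lcm_exp (W - {m}))) j"
        using excess[of W j] excess[of "W - {m}" j] fin by simp
    qed
    then have x: "xpow m * xpow (excess (W - {m})) =
        xpow (excess W) * (xpow (lcm_exp W - lcm_exp (W - {m})) :: ('n, 'k) mpoly)"
      by (simp only: xpow_add[symmetric])
    have "(?s m * xpow m) \<odot> prod_of (W - {m}) = (?s m * (xpow m * xpow (excess (W - {m})))) \<odot> img (W - {m})"
      using sub by (simp add: img(2) mult.assoc)
    also have "\<dots> = xpow (excess W) \<odot> ?t m"
      unfolding x using sub by (simp add: ac_simps)
    finally show "(?s m * xpow m) \<odot> prod_of (W - {m}) = xpow (excess W) \<odot> ?t m" .
  qed (use sub in auto)
  also have "\<dots> = xpow (excess W) \<odot> finsum F ?t W"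
    using sub by (intro smult_finsum[symmetric]) auto
  finally show "xpow (excess W) \<odot> \<partial> (img W) = xpow (excess W) \<odot> finsum F ?t W" .
  show "finsum F ?t W \<in> carrier F" using sub by (intro M.finsum_closed) auto
qed (use W bdry_closed in simp)

end

context squarefree_dga_resolution
begin

definition comparison :: "(('n \<Rightarrow> nat) set \<Rightarrow>\<^sub>0 ('n, 'k) mpoly) \<Rightarrow> 'f" where
  "comparison t = finsum F (\<lambda>W. Poly_Mapping.lookup t W \<odot> img W) (Pow G)"

lemma comparison_carrier [simp]: "comparison t \<in> carrier F"
  unfolding comparison_def by (intro M.finsum_closed) auto

lemma comparison_add: "comparison (t + t') = comparison t \<oplus> comparison t'"
proof -
  have "comparison (t + t') = finsum F (\<lambda>W. Poly_Mapping.lookup t W \<odot> img W \<oplus>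
    Poly_Mapping.lookup t' W \<odot> img W) (Pow G)"
    unfolding comparison_def by (intro M.finsum_cong') (auto simp: lookup_add add_smult)
  also have "\<dots> = comparison t \<oplus> comparison t'"
    unfolding comparison_def by (intro M.finsum_addf) auto
  finally show ?thesis .
qed

lemma comparison_smult: "comparison (Poly_Mapping.map ((*) s) t) = s \<odot> comparison t"
proof -
  have "s \<odot> comparison t = finsum F (\<lambda>W. s \<odot> (Poly_Mapping.lookup t W \<odot> img W)) (Pow G)"
    unfolding comparison_def by (intro smult_finsum) auto
  also have "\<dots> = comparison (Poly_Mapping.map ((*) s) t)"
    unfolding comparison_def by (intro M.finsum_cong') auto
  finally show ?thesis by (rule sym)
qed

lemma comparison_single:
  assumes "W \<subseteq> G"
  shows "comparison (Poly_Mapping.single W s) = s \<odot> img W"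
proof -
  have "comparison (Poly_Mapping.single W s) = finsum F (\<lambda>V. if V = W then s \<odot> img V else \<zero>) (Pow G)"
    unfolding comparison_def by (intro M.finsum_cong') (auto simp: lookup_single when_def)
  also have "\<dots> = s \<odot> img W"
    using assms by (intro M.add.finprod_singleton_swap) auto
  finally show ?thesis .
qed

lemma comparison_zero [simp]: "comparison 0 = \<zero>"
  using comparison_single[of "{}" 0] by simp

lemma comparison_sum: "comparison (sum f A) = finsum F (\<lambda>a. comparison (f a)) A"
  by (induction A rule: infinite_finite_induct) (simp_all add: comparison_add)

lemma comparison_mult:
  assumes "Poly_Mapping.keys t \<subseteq> Pow G" "Poly_Mapping.keys t' \<subseteq> Pow G"
  shows "comparison (taylor_mult r t t') = comparison t \<otimes> comparison t'"
  using assms(1)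
proof (induction t rule: taylor_linear_induct)
  case (add t s)
  with assms show ?case by (simp add: taylor_mult_add_left comparison_add mult_add)
next
  case (single W a)
  from assms(2) show ?case
  proof (induction t' rule: taylor_linear_induct)
    case (add t s)
    with single show ?case by (simp add: taylor_mult_add_right comparison_add mult_add)
  next
    case (single V b)
    with \<open>W \<subseteq> G\<close> show ?case
      by (simp add: taylor_mult_single comparison_single smult_mult_left smult_mult_right img_mult ac_simps)
  qed simp
qed simp

lemma comparison_one: "comparison (Poly_Mapping.single {} 1) = \<one>"
  by (simp add: comparison_single img_empty)

lemma taylor_bdry_eq:
  fixes t :: "('n \<Rightarrow> nat) set \<Rightarrow>\<^sub>0 ('n, 'k) mpoly"
  assumes "Poly_Mapping.keys t \<subseteq> Pow G"
  shows "taylor_bdry r t = (\<Sum>W\<in>Pow G. \<Sum>m\<in>W. Poly_Mapping.single (W - {m})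
     (Poly_Mapping.lookup t W * ((-1) ^ card {m'\<in>W. (m', m) \<in> r} * xpow (lcm_exp W - lcm_exp (W - {m})))))"
  unfolding taylor_bdry_def using assms
  by (intro sum.mono_neutral_left) (auto simp: not_in_keys_iff_lookup_eq_zero)

lemma taylor_bdry_closed:
  fixes t :: "('n \<Rightarrow> nat) set \<Rightarrow>\<^sub>0 ('n, 'k) mpoly"
  assumes "Poly_Mapping.keys t \<subseteq> Pow G"
  shows "Poly_Mapping.keys (taylor_bdry r t) \<subseteq> Pow G"
  unfolding taylor_bdry_eq[OF assms] by (intro keys_subset_sum) auto

lemma comparison_bdry:
  assumes "Poly_Mapping.keys t \<subseteq> Pow G"
  shows "comparison (taylor_bdry r t) = \<partial> (comparison t)"
proof -
  let ?c = "\<lambda>W m. (-1) ^ card {m'\<in>W. (m', m) \<in> r} * xpow (lcm_exp W - lcm_exp (W - {m})) :: ('n, 'k) mpoly"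
  have basis_term: "comparison (\<Sum>m\<in>W. Poly_Mapping.single (W - {m}) (s * ?c W m)) = s \<odot> \<partial> (img W)"
    if W: "W \<subseteq> G" for W s
  proof -
    have sub: "W - {m} \<subseteq> G" for m using W by blast
    have "comparison (\<Sum>m\<in>W. Poly_Mapping.single (W - {m}) (s * ?c W m)) =
      finsum F (\<lambda>m. s \<odot> (?c W m \<odot> img (W - {m}))) W"
      unfolding comparison_sum using sub by (intro M.finsum_cong') (auto simp: comparison_single)
    also have "\<dots> = s \<odot> \<partial> (img W)"
      unfolding img_bdry[OF W] using sub by (intro smult_finsum[symmetric]) auto
    finally show ?thesis .
  qed
  have "\<partial> (comparison t) = finsum F (\<lambda>W. Poly_Mapping.lookup t W \<odot> \<partial> (img W)) (Pow G)"
    unfolding comparison_def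
    by (subst bdry_finsum) (auto simp: bdry_smult bdry_closed intro!: M.finsum_cong')
  also have "\<dots> = comparison (taylor_bdry r t)"
    unfolding taylor_bdry_eq[OF assms] comparison_sum[of _ "Pow G"]
    by (intro M.finsum_cong') (auto simp: basis_term)
  finally show ?thesis by (rule sym)
qed

lemma comparison_bicomp:
  assumes "t \<in> bicomp T i u"
  shows "comparison t \<in> bicomp F i u"
proof -
  have "Poly_Mapping.lookup t W \<odot> img W \<in> bicomp F i u" if W: "W \<in> Pow G" for W
  proof (cases "Poly_Mapping.lookup t W = 0")
    case True
    then show ?thesis using W by simp
  next
    case False
    then have "card W = i" "homogeneous_poly (u - mdeg (lcm_exp W)) (Poly_Mapping.lookup t W)"
      using assms by (auto simp: bicomp_taylor_iff)
    with smult_bicomp[OF this(2) img(1)[of W]] W show ?thesis by simp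
  qed
  then show ?thesis unfolding comparison_def by (rule bicomp_finsum)
qed


section \<open>Surjectivity\<close>

lemma sign_single:
  "(-1) ^ n * Poly_Mapping.single e c = Poly_Mapping.single e ((-1) ^ n * (c :: 'k))"
  by (induction n) (simp_all add: single_uminus)

text \<open>Multiplication by \<open>g\<^sub>m\<close> followed by division by \<open>x\<^sup>m\<close> can be performed in the Taylor algebra on
  elements whose multidegree is a multiple of \<open>m\<close>. On a basis element it turns \<open>g\<^sub>W\<close> into a multiple of
  the element for \<open>insert m W\<close>, the lcm of which still divides the degree.\<close>

lemma divided_product:
  assumes m: "m \<in> G" "mdeg m \<le> u" and t: "t \<in> bicomp T k u"
  obtains t' where "t' \<in> bicomp T (Suc k) u" "xpow m \<odot> comparison t' = gen m \<otimes> comparison t"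
proof -
  have "\<exists>s. s \<in> bicomp T (Suc k) u \<and>
    xpow m \<odot> comparison s = gen m \<otimes> (Poly_Mapping.lookup t W \<odot> img W)" if W: "W \<subseteq> G" for W
  proof (cases "Poly_Mapping.lookup t W = 0 \<or> m \<in> W")
    case True
    have "gen m \<otimes> img W = \<zero>" if "m \<in> W"
      using img_mult[of "{m}" W] m W that by (simp add: img_singleton taylor_basis_mult_eq_0)
    then have "gen m \<otimes> (Poly_Mapping.lookup t W \<odot> img W) = \<zero>"
      using True m W by (auto simp: smult_mult_right)
    then show ?thesis by (intro exI[of _ 0]) simp
  next
    case False
    then have m_W: "m \<notin> W" and "card W = k" "homogeneous_poly (u - mdeg (lcm_exp W)) (Poly_Mapping.lookup t W)"
      using t by (auto simp: bicomp_taylor_iff)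
    then obtain a c where a: "u - mdeg (lcm_exp W) = mdeg a" and c: "Poly_Mapping.lookup t W = Poly_Mapping.single a c"
      using homogeneous_polyE False by metis
    let ?V = "{m} \<union> W"
    let ?s = "(-1) ^ inversions r {m} W :: 'k"
    have fin: "finite W" and V: "?V \<subseteq> G" using W m(1) finite_subset_G by auto
    have u: "u j = int (lcm_exp W j) + int (a j)" for j
      using fun_cong[OF a, of j] by simp
    have le: "lcm_exp ?V j \<le> lcm_exp W j + a j" for j
      using le_funD[OF m(2), of j] u[of j] lcm_exp_Un[of "{m}" W j] fin by simp
    \<comment> \<open>the exponent that completes \<open>lcm_exp ?V\<close> to the degree \<open>u\<close>\<close>
    define e where "e = (\<lambda>j. lcm_exp W j + a j - lcm_exp ?V j)"
    have "u = mdeg (lcm_exp ?V) + mdeg e"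
    proof
      show "u j = (mdeg (lcm_exp ?V) + mdeg e) j" for j
        using u[of j] le[of j] by (simp add: e_def)
    qed
    from bicomp_taylor_single[OF V this] have "Poly_Mapping.single ?V (Poly_Mapping.single e (?s * c)) \<in> bicomp T (Suc k) u"
      using m_W fin \<open>card W = k\<close> by simp
    moreover have "xpow m * Poly_Mapping.single e (?s * c) = Poly_Mapping.single a c * taylor_basis_mult r {m} W"
    proof -
      have "m + e = (lcm_exp {m} + lcm_exp W - lcm_exp ?V) + a"
      proof
        fix j
        have "lcm_exp ?V j \<le> m j + lcm_exp W j"
          using fin by (simp only: lcm_exp_Un finite.intros) simp
        with le[of j] show "(m + e) j = ((lcm_exp {m} + lcm_exp W - lcm_exp ?V) + a) j"
          by (simp add: e_def)
      qed
      then have "xpow m * Poly_Mapping.single e (?s * c) =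
        xpow (lcm_exp {m} + lcm_exp W - lcm_exp ?V) * Poly_Mapping.single a (?s * c)"
        unfolding xpow_mult_single by simp
      also have "\<dots> = Poly_Mapping.single a c * taylor_basis_mult r {m} W"
        using m_W unfolding sign_single[symmetric]
        by (subst taylor_basis_mult_disjoint) (simp_all only: mult.assoc mult.commute mult.left_commute, auto)
      finally show ?thesis .
    qed
    then have "xpow m \<odot> comparison (Poly_Mapping.single ?V (Poly_Mapping.single e (?s * c))) =
        (Poly_Mapping.single a c * taylor_basis_mult r {m} W) \<odot> img ?V"
      using V by (simp only: comparison_single smult_smult[OF img_carrier])
    moreover have "gen m \<otimes> (Poly_Mapping.lookup t W \<odot> img W) =
        (Poly_Mapping.single a c * taylor_basis_mult r {m} W) \<odot> img ?V"
      using img_mult[of "{m}" W] m(1) W V unfolding c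
      by (simp add: img_singleton smult_mult_right)
    ultimately show ?thesis by metis
  qed
  then obtain s where s: "\<And>W. W \<subseteq> G \<Longrightarrow> s W \<in> bicomp T (Suc k) u"
    "\<And>W. W \<subseteq> G \<Longrightarrow> xpow m \<odot> comparison (s W) = gen m \<otimes> (Poly_Mapping.lookup t W \<odot> img W)"
    by metis
  show thesis
  proof (rule that)
    show "sum s (Pow G) \<in> bicomp T (Suc k) u"
      using s(1) by (intro bicomp_taylor_sum) auto
    have "xpow m \<odot> comparison (sum s (Pow G)) = finsum F (\<lambda>W. xpow m \<odot> comparison (s W)) (Pow G)"
      unfolding comparison_sum by (intro smult_finsum) auto
    also have "\<dots> = finsum F (\<lambda>W. gen m \<otimes> (Poly_Mapping.lookup t W \<odot> img W)) (Pow G)"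
      using m by (intro M.finsum_cong') (auto simp: s(2))
    also have "\<dots> = gen m \<otimes> comparison t"
      unfolding comparison_def using m by (intro mult_finsum[symmetric]) auto
    finally show "xpow m \<odot> comparison (sum s (Pow G)) = gen m \<otimes> comparison t" .
  qed
qed

lemma homogeneous_poly_mult:
  assumes "homogeneous_poly v p" "homogeneous_poly w q"
  shows "homogeneous_poly (v + w) (p * q)"
  unfolding homogeneous_poly_def
proof
  fix e assume "e \<in> Poly_Mapping.keys (p * q)"
  then obtain a b where "a \<in> Poly_Mapping.keys p" "b \<in> Poly_Mapping.keys q" "e = a + b"
    using keys_mult[of p q] by blast
  moreover from this have "mdeg a = v" "mdeg b = w"
    using assms by (auto simp: homogeneous_poly_def)
  ultimately show "mdeg e = v + w" by (auto simp: fun_eq_iff)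
qed

lemma bicomp_taylor_smult:
  assumes "t \<in> bicomp T i (u - v)" "homogeneous_poly v s"
  shows "Poly_Mapping.map ((*) s) t \<in> bicomp T i u"
  unfolding bicomp_taylor_iff
proof (intro conjI allI impI)
  show "homogeneous_poly (u - mdeg (lcm_exp W)) (Poly_Mapping.lookup (Poly_Mapping.map ((*) s) t) W)" for W
  proof -
    have "homogeneous_poly (u - v - mdeg (lcm_exp W)) (Poly_Mapping.lookup t W)"
      using assms(1) by (simp add: bicomp_taylor_iff)
    moreover have "v + (u - v - mdeg (lcm_exp W)) = u - mdeg (lcm_exp W)"
      by (simp add: fun_eq_iff)
    ultimately show ?thesis
      using homogeneous_poly_mult[OF assms(2)] by (metis lookup_map_times)
  qed
  fix W assume "Poly_Mapping.lookup (Poly_Mapping.map ((*) s) t) W \<noteq> 0"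
  then have "Poly_Mapping.lookup t W \<noteq> 0" by auto
  then show "W \<subseteq> G" "card W = i" using assms(1) by (simp_all add: bicomp_taylor_iff)
qed

text \<open>Given \<open>x\<close> in \<open>F\<^sub>i\<^sub>+\<^sub>1\<close> whose boundary is the image of \<open>t\<close>, and a generator \<open>m\<close> dividing the degree
  of \<open>x\<close>, the element \<open>z = g\<^sub>m \<partial>x / x\<^sup>m\<close> is in the image and has the same boundary as \<open>x\<close>, by the
  Leibniz rule, as required for \<open>graded_nakayama\<close>.\<close>

lemma comparison_surj_bicomp:
  "x \<in> bicomp F i u \<Longrightarrow> x \<in> comparison ` bicomp T i u"
proof (induction i arbitrary: u x)
  case 0
  from 0 show ?case
  proof (cases rule: bicomp_0_cases)
    case 1
    then have "x = comparison 0" by simp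
    then show ?thesis by (rule image_eqI) simp
  next
    case (2 a c)
    have "u = mdeg (lcm_exp {}) + mdeg a" using 2(1) by (simp add: fun_eq_iff)
    from bicomp_taylor_single[OF _ this, of c]
    have "Poly_Mapping.single {} (Poly_Mapping.single a c) \<in> bicomp T 0 u" by simp
    moreover have "x = comparison (Poly_Mapping.single {} (Poly_Mapping.single a c))"
      using 2(3) by (simp add: comparison_single img_empty)
    ultimately show ?thesis by blast
  qed
next
  case (Suc i)
  from Suc.prems show ?case
  proof (rule graded_nakayama[rotated -1])
    show "comparison ` bicomp T (Suc i) u \<subseteq> bicomp F (Suc i) u" for u
      using comparison_bicomp by blast
    show "\<zero> \<in> comparison ` bicomp T (Suc i) u" for u
      by (rule image_eqI[of _ _ 0]) simp_all
    show "x \<oplus> y \<in> comparison ` bicomp T (Suc i) u"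
      if "x \<in> comparison ` bicomp T (Suc i) u" "y \<in> comparison ` bicomp T (Suc i) u" for u x y
      using that by (auto simp: comparison_add[symmetric] intro!: imageI bicomp_taylor_add)
    show "xvar l \<odot> x \<in> comparison ` bicomp T (Suc i) u"
      if "x \<in> comparison ` bicomp T (Suc i) (u - mdeg (exp_unit l))" for u l x
      using that bicomp_taylor_smult[OF _ homogeneous_xpow]
      by (auto simp: comparison_smult[symmetric] xvar_def)
    show "\<exists>z\<in>comparison ` bicomp T (Suc i) u. \<partial> x = \<partial> z" if x: "x \<in> bicomp F (Suc i) u" for u x
    proof (cases "\<exists>m\<in>G. mdeg m \<le> u")
      case False
      then have "x = comparison 0" using bicomp_eq_zero[OF x] by simp
      then show ?thesis by (intro bexI[of _ x] image_eqI[of _ _ 0]) simp_all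
    next
      case True
      then obtain m where m: "m \<in> G" "mdeg m \<le> u" by blast
      obtain t where t: "t \<in> bicomp T i u" "\<partial> x = comparison t"
        using Suc.IH[OF bdry_bicomp_Suc[OF x]] by blast
      obtain t' where t': "t' \<in> bicomp T (Suc i) u" "xpow m \<odot> comparison t' = gen m \<otimes> \<partial> x"
        using divided_product[OF m t(1)] t(2) by metis
      have xc: "x \<in> carrier F" "\<partial> x \<in> carrier F" using x bdry_closed by auto
      have "xpow m \<odot> \<partial> (comparison t') = \<partial> (gen m \<otimes> \<partial> x)"
        using bdry_smult[of "comparison t'" "xpow m"] t'(2) by simp
      also have "\<dots> = (xpow m \<odot> \<one>) \<otimes> \<partial> x \<oplus> (-1) ^ 1 \<odot> (gen m \<otimes> \<partial> (\<partial> x))"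
        using leibniz[OF gen(1)[OF m(1)] bdry_bicomp_Suc[OF x]] gen(2)[OF m(1)] by simp
      also have "\<dots> = xpow m \<odot> \<partial> x"
        using xc m bdry_bdry[of x] by (simp add: smult_mult_left)
      finally have "\<partial> x = \<partial> (comparison t')"
        using xpow_smult_cancel xc bdry_closed comparison_carrier by metis
      with t'(1) show ?thesis by blast
    qed
  qed
qed

lemma comparison_surj:
  assumes "x \<in> carrier F"
  obtains t where "Poly_Mapping.keys t \<subseteq> Pow G" "comparison t = x"
proof -
  let ?D = "{d. component x d \<noteq> \<zero>}"
  have "\<exists>t. Poly_Mapping.keys t \<subseteq> Pow G \<and> comparison t = component x d" for d
    using comparison_surj_bicomp[OF component(1)[OF assms, of "fst d" "snd d"]]
    by (force simp: bicomp_taylor)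
  then obtain t where t: "\<And>d. Poly_Mapping.keys (t d) \<subseteq> Pow G" "\<And>d. comparison (t d) = component x d"
    by metis
  have "comparison (sum t ?D) = x"
    unfolding comparison_sum t(2) by (rule component(3)[OF assms])
  moreover have "Poly_Mapping.keys (sum t ?D) \<subseteq> Pow G"
    using t(1) by (rule keys_subset_sum)
  ultimately show thesis using that by blast
qed


section \<open>The quotient by the kernel\<close>

definition comparison_kernel :: "(('n \<Rightarrow> nat) set \<Rightarrow>\<^sub>0 ('n, 'k) mpoly) set" where
  "comparison_kernel = {t. Poly_Mapping.keys t \<subseteq> Pow G \<and> comparison t = \<zero>}"

lemma ideal_kernel: "ideal comparison_kernel T"
proof -
  have "ring_hom_ring T F comparison"
  proof (rule ring_hom_ringI[OF ring_taylor ring_F])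
    show "comparison (s \<otimes>\<^bsub>T\<^esub> t) = comparison s \<otimes> comparison t"
      if "s \<in> carrier T" "t \<in> carrier T" for s t
      using that comparison_mult by simp
  qed (simp_all add: comparison_add comparison_one)
  then have "ideal (a_kernel T F comparison) T"
    by (rule ring_hom_ring.kernel_is_ideal)
  moreover have "a_kernel T F comparison = comparison_kernel"
    unfolding a_kernel_def' comparison_kernel_def by simp
  ultimately show ?thesis by metis
qed

sublocale J: ideal comparison_kernel T
  by (rule ideal_kernel)

text \<open>For homogeneity: \<open>comparison\<close> preserves bidegrees, so the images of the homogeneous parts
  of an element of the kernel are the components of zero.\<close>

lemma dg_ideal_kernel: "dg_ideal comparison_kernel T"
proof (intro dg_ideal.intro dg_ideal_axioms.intro ideal_kernel)
  show "bdry T ` comparison_kernel \<subseteq> comparison_kernel"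
    by (auto simp: comparison_kernel_def taylor_bdry_closed comparison_bdry dest: subsetD[OF taylor_bdry_closed])
  fix t assume "t \<in> comparison_kernel"
  then have t: "Poly_Mapping.keys t \<subseteq> Pow G" "comparison t = \<zero>"
    by (auto simp: comparison_kernel_def)
  obtain D f where D: "finite D" "\<And>i u. f (i, u) \<in> bicomp T i u" "\<And>d. d \<notin> D \<Longrightarrow> f d = 0" "t = sum f D"
    using taylor_homogeneous_parts[OF t(1)] by metis
  have "component (finsum F (\<lambda>d. comparison (f d)) D) = (\<lambda>d. comparison (f d))"
    by (rule component_eqI) (use D comparison_bicomp in auto)
  then have "comparison (f d) = component (comparison t) d" for d
    using D(4) by (simp add: comparison_sum)
  then have "comparison (f d) = \<zero>" for d using t(2) by simp
  moreover have "Poly_Mapping.keys (f d) \<subseteq> Pow G" for d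
    using D(2)[of "fst d" "snd d"] by (simp add: bicomp_taylor)
  ultimately have f: "f d \<in> comparison_kernel" for d by (simp add: comparison_kernel_def)
  have sub: "{d. f d \<noteq> 0} \<subseteq> D" using D(3) by blast
  have "finsum T f {d. f d \<noteq> \<zero>\<^bsub>T\<^esub>} = sum f {d. f d \<noteq> 0}"
    using f by (subst taylor_finsum) (auto simp: comparison_kernel_def)
  also have "\<dots> = t"
    unfolding D(4) using D(1) sub by (intro sum.mono_neutral_left) auto
  finally show "\<exists>f. (\<forall>i u. f (i, u) \<in> comparison_kernel \<inter> bicomp T i u) \<and>
      finite {d. f d \<noteq> \<zero>\<^bsub>T\<^esub>} \<and> t = finsum T f {d. f d \<noteq> \<zero>\<^bsub>T\<^esub>}"
    using f D(2) finite_subset[OF sub D(1)] by (intro exI[of _ f]) auto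
qed

text \<open>The fibres of \<open>comparison\<close> are the cosets of its kernel. Sending an element of \<open>F\<close> to its fibre is
  therefore inverse to the map that \<open>comparison\<close> induces on the quotient.\<close>

definition fibre :: "'f \<Rightarrow> (('n \<Rightarrow> nat) set \<Rightarrow>\<^sub>0 ('n, 'k) mpoly) set" where
  "fibre x = {t. Poly_Mapping.keys t \<subseteq> Pow G \<and> comparison t = x}"

lemma coset_eq_fibre:
  assumes t: "Poly_Mapping.keys t \<subseteq> Pow G"
  shows "comparison_kernel +>\<^bsub>T\<^esub> t = fibre (comparison t)"
proof
  show "comparison_kernel +>\<^bsub>T\<^esub> t \<subseteq> fibre (comparison t)"
    unfolding a_r_coset_def' using t
    by (auto simp: comparison_kernel_def fibre_def comparison_add dest!: subsetD[OF keys_add])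
  show "fibre (comparison t) \<subseteq> comparison_kernel +>\<^bsub>T\<^esub> t"
  proof
    fix s assume "s \<in> fibre (comparison t)"
    then have s: "Poly_Mapping.keys s \<subseteq> Pow G" "comparison s = comparison t"
      by (auto simp: fibre_def)
    have "Poly_Mapping.keys (s - t) \<subseteq> Pow G"
    proof
      fix W assume "W \<in> Poly_Mapping.keys (s - t)"
      then have "W \<in> Poly_Mapping.keys s \<or> W \<in> Poly_Mapping.keys t"
        by (auto simp: in_keys_iff lookup_minus)
      then show "W \<in> Pow G" using s(1) t by blast
    qed
    moreover have "comparison (s - t) \<oplus> comparison t = comparison t"
      using s(2) comparison_add[of "s - t" t] by simp
    then have "comparison (s - t) = \<zero>"
      using M.add.r_cancel_one' comparison_carrier by metis
    ultimately have "s - t \<in> comparison_kernel" by (simp add: comparison_kernel_def)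
    moreover have "s = (s - t) + t" by simp
    ultimately show "s \<in> comparison_kernel +>\<^bsub>T\<^esub> t"
      unfolding a_r_coset_def' by (auto intro!: bexI[of _ "s - t"])
  qed
qed

lemma fibre_iso: "fibre \<in> mdga_iso F (dg_quotient T comparison_kernel)"
proof -
  let ?Q = "dg_quotient T comparison_kernel"
  have fibre_nonempty: "\<exists>t. t \<in> fibre x" if "x \<in> carrier F" for x
    using comparison_surj[OF that] by (auto simp: fibre_def)
  have carrier_Q: "carrier ?Q = fibre ` carrier F"
  proof -
    have "carrier ?Q = (\<lambda>t. comparison_kernel +>\<^bsub>T\<^esub> t) ` carrier T"
      by (auto simp: dg_quotient_def FactRing_def A_RCOSETS_def')
    also have "\<dots> = fibre ` carrier F"
      using comparison_surj by (auto simp: coset_eq_fibre image_iff)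
    finally show ?thesis .
  qed
  have "fibre \<in> ring_iso F ?Q"
  proof (rule ring_iso_memI)
    show "fibre x \<in> carrier ?Q" if "x \<in> carrier F" for x
      using that carrier_Q by blast
    show "fibre \<one> = \<one>\<^bsub>?Q\<^esub>"
      using coset_eq_fibre[of "Poly_Mapping.single {} 1"] comparison_one
      by (simp add: dg_quotient_def FactRing_def)
    fix x y assume "x \<in> carrier F" "y \<in> carrier F"
    then obtain s t where *: "Poly_Mapping.keys s \<subseteq> Pow G" "comparison s = x"
      "Poly_Mapping.keys t \<subseteq> Pow G" "comparison t = y"
      using comparison_surj by metis
    have "fibre (x \<otimes> y) = comparison_kernel +>\<^bsub>T\<^esub> (s \<otimes>\<^bsub>T\<^esub> t)"
      using * by (simp add: coset_eq_fibre taylor_mult_closed comparison_mult)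
    also have "\<dots> = rcoset_mult T comparison_kernel (fibre x) (fibre y)"
      using J.rcoset_mult_add[of s t] * by (simp add: coset_eq_fibre)
    finally show "fibre (x \<otimes> y) = fibre x \<otimes>\<^bsub>?Q\<^esub> fibre y"
      by (simp add: dg_quotient_def FactRing_def)
    have "fibre (x \<oplus> y) = comparison_kernel +>\<^bsub>T\<^esub> (s \<oplus>\<^bsub>T\<^esub> t)"
      using * by (simp add: coset_eq_fibre keys_subset_add comparison_add)
    also have "\<dots> = fibre x <+>\<^bsub>T\<^esub> fibre y"
      using J.a_rcos_sum[of s t] * by (simp add: coset_eq_fibre)
    finally show "fibre (x \<oplus> y) = fibre x \<oplus>\<^bsub>?Q\<^esub> fibre y"
      by (simp add: dg_quotient_def FactRing_def)
  next
    have "inj_on fibre (carrier F)"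
      using fibre_nonempty by (intro inj_onI) (auto simp: fibre_def)
    with carrier_Q show "bij_betw fibre (carrier F) (carrier ?Q)"
      by (simp add: bij_betw_def)
  qed
  moreover have "fibre (s \<odot> x) = s \<odot>\<^bsub>?Q\<^esub> fibre x" if x: "x \<in> carrier F" for s x
  proof -
    have keys: "Poly_Mapping.keys (Poly_Mapping.map ((*) s) t) \<subseteq> Pow G" if "Poly_Mapping.keys t \<subseteq> Pow G"
      for t :: "('n \<Rightarrow> nat) set \<Rightarrow>\<^sub>0 ('n, 'k) mpoly"
    proof
      fix W assume "W \<in> Poly_Mapping.keys (Poly_Mapping.map ((*) s) t)"
      then have "W \<in> Poly_Mapping.keys t" by (auto simp: in_keys_iff)
      then show "W \<in> Pow G" using that by blast
    qed
    have "comparison_kernel +>\<^bsub>T\<^esub> (s \<odot>\<^bsub>T\<^esub> t) = fibre (s \<odot> x)" if "t \<in> fibre x" for t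
      using that keys by (simp add: fibre_def coset_eq_fibre comparison_smult)
    then have "(\<Union>t\<in>fibre x. comparison_kernel +>\<^bsub>T\<^esub> (s \<odot>\<^bsub>T\<^esub> t)) = fibre (s \<odot> x)"
      using fibre_nonempty[OF x] by blast
    then show ?thesis by (simp add: dg_quotient_def)
  qed
  moreover have "fibre (\<partial> x) = bdry ?Q (fibre x)" if x: "x \<in> carrier F" for x
  proof -
    have "comparison_kernel +>\<^bsub>T\<^esub> (bdry T t) = fibre (\<partial> x)" if "t \<in> fibre x" for t
      using that by (simp add: fibre_def coset_eq_fibre comparison_bdry taylor_bdry_closed)
    then have "(\<Union>t\<in>fibre x. comparison_kernel +>\<^bsub>T\<^esub> (bdry T t)) = fibre (\<partial> x)"
      using fibre_nonempty[OF x] by blast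
    then show ?thesis by (simp add: dg_quotient_def)
  qed
  moreover have "fibre ` bicomp F i u = bicomp ?Q i u" for i u
  proof -
    have "bicomp F i u = comparison ` bicomp T i u"
      using comparison_surj_bicomp comparison_bicomp by blast
    then have "fibre ` bicomp F i u = (\<lambda>t. fibre (comparison t)) ` bicomp T i u"
      by (simp add: image_image)
    also have "\<dots> = (\<lambda>t. comparison_kernel +>\<^bsub>T\<^esub> t) ` bicomp T i u"
      by (intro image_cong) (auto simp: coset_eq_fibre bicomp_taylor)
    finally show ?thesis by (simp add: dg_quotient_def)
  qed
  ultimately show ?thesis by (simp add: mdga_iso_def)
qed

end

theorem theorem3p6:
  fixes I :: "('n::finite, 'k::field) mpoly set"
    and r :: "(('n \<Rightarrow> nat) \<times> ('n \<Rightarrow> nat)) set"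
    and F :: "('n, 'k, 'f) mdga"
  assumes "squarefree_monomial_ideal I" and "I \<noteq> UNIV"
    and "strict_linear_order_on (min_gens I) r"
    and "minimal_multigraded_free_resolution I F"
    and "multigraded_dga F"
  shows "\<exists>J. dg_ideal J (taylor I r) \<and>
    (\<exists>\<phi>. \<phi> \<in> mdga_iso F (dg_quotient (taylor I r) J))"
proof -
  interpret squarefree_dga_resolution I F r
    using assms
    by (intro squarefree_dga_resolution.intro squarefree_resolution.intro taylor_algebra.intro
        squarefree_ideal.intro taylor_algebra_axioms.intro)
  show ?thesis
    using dg_ideal_kernel fibre_iso by blast
qed

end
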